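(* Suppose that $w=(w_n)_{n=1}^\infty$ is a regular weight decreasing to zero such that its primitive weight $s=(s_n)_{n=1}^\infty$ is submultiplicative. Then the separable part $m_s^0$ of the Marcinkiewicz sequence space $m_s$ has a unique greedy basis.
   Context: A weight is a sequence $w=(w_n)_{n=1}^\infty$ of positive numbers whose primitive weight $s=(s_n)_{n=1}^\infty$, $s_n=\sum_{i=1}^n w_i$, satisfies the doubling condition $\sup_n s_{2n}/s_n<\infty$. "Decreasing to zero" means non-increasing with limit $0$. The weight $w$ is regular if there is a constant $C$ with $s_n/n\le C w_n$ for all $n$ (in particular $s_n\to\infty$ then). The sequence $s$ is submultiplicative if $\sup_{n,k\ge1} s_{nk}/(s_ns_k)<\infty$. The Marcinkiewicz sequence space $m_s$ consists of all real sequences $(a_n)\in c_0$ with $\|(a_n)\|_{m_s}=\sup_n \frac1{s_n}\sum_{i=1}^n a_i^*<\infty$, where $(a_n^* )$ is the decreasing rearrangement of $(|a_n|)$; $m_s^0$ is the closure in $m_s$ of the space $c_{00}$ of finitely supported sequences. (The canonical unit vectors form a symmetric, hence greedy, basis of $m_s^0$.) Bases: a basis is a Schauder basis $(x_n)_{n=1}^\infty$, and all bases are assumed semi-normalized, i.e. $0<\inf_n\|x_n\|\le\sup_n\|x_n\|<\infty$. A basis $(x_n)$ of $X$ with biorthogonal functionals $(x_n^* )$ is greedy if there is a constant $C$ such that for every $x\in X$, every $N\in\mathbb{N}$, and every set $\Lambda\subseteq\mathbb{N}$ with $|\Lambda|=N$ and $\min_{n\in\Lambda}|x_n^*(x)|\ge\max_{n\notin\Lambda}|x_n^*(x)|$,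 one has $\|x-\sum_{n\in\Lambda}x_n^*(x)x_n\|\le C\inf\{\|x-\sum_{n\in A}\alpha_n x_n\| : |A|=N,\ \alpha_n\in\mathbb{R}\}$. Two bases $(x_n)$, $(y_n)$ are equivalent if there is $C\ge1$ with $C^{-1}\|\sum a_nx_n\|\le\|\sum a_ny_n\|\le C\|\sum a_nx_n\|$ for all finitely supported real sequences $(a_n)$. A Banach space has a unique greedy basis if it has a semi-normalized greedy basis $(e_n)$ and every semi-normalized greedy basis of the space is equivalent to $(e_n)$. *)

theory Defs
  imports "HOL-Analysis.Analysis" "HOL-Library.Function_Algebras"
begin

text \<open>
  All sequences are indexed from \<open>0\<close>: the value \<open>w n\<close> below is the term usually
  written \<open>w_{n+1}\<close>. In contrast \<open>primitive_weight w n\<close> is the sum of the first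
  \<open>n\<close> terms, that is, the usual \<open>s_n\<close>, and only its values for \<open>n \<ge> 1\<close> are relevant.

  The space considered depends on the weight, so it cannot be a type. A normed space is
  therefore given by a carrier set \<open>V\<close> in a real vector space and a norm function
  \<open>nrm\<close> on it; for sequence spaces the ambient vector space consists of all real
  sequences with pointwise operations.
\<close>

instantiation "fun" :: (type, real_vector) real_vector
begin

definition scaleR_fun :: "real \<Rightarrow> ('a \<Rightarrow> 'b) \<Rightarrow> 'a \<Rightarrow> 'b" where
  "scaleR_fun c f = (\<lambda>x. c *\<^sub>R f x)"

instance
  by standard (auto simp: scaleR_fun_def fun_eq_iff scaleR_add_right scaleR_add_left)

end

definition primitive_weight :: "(nat \<Rightarrow> real) \<Rightarrow> nat \<Rightarrow> real" where
  "primitive_weight w n = (\<Sum>i<n. w i)"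

definition is_weight :: "(nat \<Rightarrow> real) \<Rightarrow> bool" where
  "is_weight w \<longleftrightarrow> (\<forall>n. 0 < w n) \<and>
     bdd_above ((\<lambda>n. primitive_weight w (2 * n) / primitive_weight w n) ` {1..})"

definition decreasing_to_zero :: "(nat \<Rightarrow> real) \<Rightarrow> bool" where
  "decreasing_to_zero w \<longleftrightarrow> decseq w \<and> w \<longlonglongrightarrow> 0"

definition regular_weight :: "(nat \<Rightarrow> real) \<Rightarrow> bool" where
  "regular_weight w \<longleftrightarrow>
     (\<exists>C. \<forall>n. primitive_weight w (Suc n) / real (Suc n) \<le> C * w n)"

definition submultiplicative :: "(nat \<Rightarrow> real) \<Rightarrow> bool" where
  "submultiplicative s \<longleftrightarrow>
     bdd_above {s (n * k) / (s n * s k) | n k. 1 \<le> n \<and> 1 \<le> k}"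

text \<open>
  The decreasing rearrangement via the distribution function. The finiteness guard is
  needed because \<open>card\<close> of an infinite set is \<open>0\<close>.
\<close>

definition decreasing_rearrangement :: "(nat \<Rightarrow> real) \<Rightarrow> nat \<Rightarrow> real" where
  "decreasing_rearrangement a n =
     Inf {t. 0 \<le> t \<and> finite {i. t < \<bar>a i\<bar>} \<and> card {i. t < \<bar>a i\<bar>} \<le> n}"

definition marcinkiewicz_mean :: "(nat \<Rightarrow> real) \<Rightarrow> (nat \<Rightarrow> real) \<Rightarrow> nat \<Rightarrow> real" where
  "marcinkiewicz_mean s a n = (1 / s n) * (\<Sum>i<n. decreasing_rearrangement a i)"

definition marcinkiewicz_norm :: "(nat \<Rightarrow> real) \<Rightarrow> (nat \<Rightarrow> real) \<Rightarrow> real" where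
  "marcinkiewicz_norm s a = (SUP n\<in>{1..}. marcinkiewicz_mean s a n)"

definition marcinkiewicz_space :: "(nat \<Rightarrow> real) \<Rightarrow> (nat \<Rightarrow> real) set" where
  "marcinkiewicz_space s = {a. a \<longlonglongrightarrow> 0 \<and> bdd_above (marcinkiewicz_mean s a ` {1..})}"

definition c00 :: "(nat \<Rightarrow> real) set" where
  "c00 = {a. finite {i. a i \<noteq> 0}}"

definition marcinkiewicz_separable_part :: "(nat \<Rightarrow> real) \<Rightarrow> (nat \<Rightarrow> real) set" where
  "marcinkiewicz_separable_part s =
     {a \<in> marcinkiewicz_space s. \<forall>\<epsilon>>0. \<exists>b\<in>c00. marcinkiewicz_norm s (a - b) < \<epsilon>}"

definition expands ::
  "('v::real_vector \<Rightarrow> real) \<Rightarrow> (nat \<Rightarrow> 'v) \<Rightarrow> 'v \<Rightarrow> (nat \<Rightarrow> real) \<Rightarrow> bool" where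
  "expands nrm x v a \<longleftrightarrow> (\<lambda>m. nrm (v - (\<Sum>n<m. a n *\<^sub>R x n))) \<longlonglongrightarrow> 0"

definition schauder_basis ::
  "'v::real_vector set \<Rightarrow> ('v \<Rightarrow> real) \<Rightarrow> (nat \<Rightarrow> 'v) \<Rightarrow> bool" where
  "schauder_basis V nrm x \<longleftrightarrow> (\<forall>n. x n \<in> V) \<and> (\<forall>v\<in>V. \<exists>!a. expands nrm x v a)"

text \<open>For a Schauder basis, \<open>basis_coeff nrm x v n\<close> is the value at \<open>v\<close> of the
  \<open>n\<close>-th biorthogonal functional.\<close>

definition basis_coeff ::
  "('v::real_vector \<Rightarrow> real) \<Rightarrow> (nat \<Rightarrow> 'v) \<Rightarrow> 'v \<Rightarrow> nat \<Rightarrow> real" where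
  "basis_coeff nrm x v = (THE a. expands nrm x v a)"

definition semi_normalized ::
  "('v::real_vector \<Rightarrow> real) \<Rightarrow> (nat \<Rightarrow> 'v) \<Rightarrow> bool" where
  "semi_normalized nrm x \<longleftrightarrow>
     0 < (INF n. nrm (x n)) \<and> bdd_above (range (\<lambda>n. nrm (x n)))"

definition best_approx_error ::
  "('v::real_vector \<Rightarrow> real) \<Rightarrow> (nat \<Rightarrow> 'v) \<Rightarrow> 'v \<Rightarrow> nat \<Rightarrow> real" where
  "best_approx_error nrm x v N =
     Inf {nrm (v - (\<Sum>n\<in>A. \<alpha> n *\<^sub>R x n)) | A \<alpha>. finite A \<and> card A = N}"

definition greedy_basis ::
  "'v::real_vector set \<Rightarrow> ('v \<Rightarrow> real) \<Rightarrow> (nat \<Rightarrow> 'v) \<Rightarrow> bool" where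
  "greedy_basis V nrm x \<longleftrightarrow> schauder_basis V nrm x \<and> semi_normalized nrm x \<and>
     (\<exists>C. \<forall>v\<in>V. \<forall>N. \<forall>\<Lambda>. finite \<Lambda> \<longrightarrow> card \<Lambda> = N \<longrightarrow>
        (\<forall>n\<in>\<Lambda>. \<forall>m\<in>-\<Lambda>. \<bar>basis_coeff nrm x v m\<bar> \<le> \<bar>basis_coeff nrm x v n\<bar>) \<longrightarrow>
        nrm (v - (\<Sum>n\<in>\<Lambda>. basis_coeff nrm x v n *\<^sub>R x n)) \<le> C * best_approx_error nrm x v N)"

definition equivalent_bases ::
  "('v::real_vector \<Rightarrow> real) \<Rightarrow> (nat \<Rightarrow> 'v) \<Rightarrow> (nat \<Rightarrow> 'v) \<Rightarrow> bool" where
  "equivalent_bases nrm x y \<longleftrightarrow> (\<exists>C\<ge>1. \<forall>a\<in>c00.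
     inverse C * nrm (\<Sum>n | a n \<noteq> 0. a n *\<^sub>R x n) \<le> nrm (\<Sum>n | a n \<noteq> 0. a n *\<^sub>R y n) \<and>
     nrm (\<Sum>n | a n \<noteq> 0. a n *\<^sub>R y n) \<le> C * nrm (\<Sum>n | a n \<noteq> 0. a n *\<^sub>R x n))"

definition has_unique_greedy_basis :: "'v::real_vector set \<Rightarrow> ('v \<Rightarrow> real) \<Rightarrow> bool" where
  "has_unique_greedy_basis V nrm \<longleftrightarrow>
     (\<exists>e. greedy_basis V nrm e \<and> (\<forall>x. greedy_basis V nrm x \<longrightarrow> equivalent_bases nrm e x))"

end

theory Submission
  imports Defs
begin

text \<open>
  Write \<open>N\<close> for the Marcinkiewicz norm, \<open>V\<close> for the separable part, \<open>e_j\<close> for the unit vectors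
  and \<open>s_n\<close> for the primitive weight. For a null sequence \<open>a\<close> the norm \<open>N a\<close> is the supremum
  of \<open>(\<Sum>i\<in>B. \<bar>a i\<bar>) / s_{card B}\<close> over the finite sets \<open>B\<close>, and in this form the greedy property
  of the unit vectors is a direct exchange argument (\<open>norm_minus_greedy_sum_le\<close>).

  Let \<open>(x_n)\<close> be another greedy basis, with biorthogonal functionals \<open>x_n*\<close>. Two applications of
  the greedy inequality show that it is unconditional and democratic. The equivalence with
  \<open>(e_j)\<close> then comes from two facts about coordinates:

  \<^item> some \<open>\<delta> > 0\<close> satisfies \<open>sup_j \<bar>x_n(j)\<bar> \<ge> \<delta>\<close> for all \<open>n\<close> (\<open>coord_uniformly_large\<close>),
  \<^item> some \<open>\<delta> > 0\<close> satisfies \<open>sup_j \<bar>x_n*(e_j)\<bar> \<ge> \<delta>\<close> for all \<open>n\<close> (\<open>dual_coord_uniformly_large\<close>).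

  Choose \<open>j_n\<close> attaining these bounds. Each \<open>j\<close> occurs boundedly often, so one may treat
  \<open>n \<mapsto> j_n\<close> as injective. Unconditionality allows the signs of the coefficients to be changed
  freely, and signs can be chosen such that the off-diagonal terms of a double sum do no harm
  (\<open>signs_dominate_diagonal\<close>). Testing a combination of the \<open>x_n\<close> on the coordinates \<open>j_n\<close>
  therefore bounds its norm below by the norm of the same combination of the \<open>e_n\<close>; testing the
  functionals \<open>x_n*\<close> on the vectors \<open>\<Sum> \<plusminus> w_{\<sigma>(n)} e_{j_n}\<close>, which have norm at most \<open>1\<close>, gives
  the converse bound by duality between \<open>m_s\<close> and the Lorentz space with weight \<open>w\<close>.

  If one of the two facts failed, there would be vectors \<open>v_n\<close> of arbitrarily small sup norm,
  dominated by \<open>x_n\<close>, with \<open>x_n*(v_n) \<ge> 1/2\<close>: either \<open>x_n\<close> itself, or \<open>x_n\<close> with its few large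
  coordinates removed. Flat vectors of \<open>V\<close> can be selected so that their sums stay bounded, as in
  \<open>c_0\<close>; by unconditionality the sums of the corresponding \<open>x_n\<close> stay bounded, and by democracy
  so do all sums \<open>\<Sum>n\<in>A. x_n\<close>. Then \<open>(x_n)\<close> would be equivalent to the basis of \<open>c_0\<close>, and almost
  disjoint expansions of the \<open>e_j\<close> would give bounded sums \<open>e_{j_1} + \<dots> + e_{j_k}\<close>, whereas
  the norm of such a sum is at least \<open>k / s_k\<close>, which is unbounded as \<open>w\<close> tends to \<open>0\<close>
  (\<open>no_flat_test_vectors\<close>, \<open>basis_sums_unbounded\<close>). Regularity enters through \<open>s_n \<rightarrow> \<infinity>\<close>.
\<close>


section \<open>Sign choices and selections\<close>

text \<open>
  Averaged over all signs the off-diagonal terms cancel, so some choice does at least as well as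
  the diagonal. The induction fixes one sign at a time so that the new cross terms are nonnegative.
\<close>

lemma signs_dominate_diagonal:
  fixes z :: "'i \<Rightarrow> 'i \<Rightarrow> real"
  assumes "finite A"
  shows "\<exists>\<epsilon>. (\<forall>n. \<epsilon> n \<in> {-1, 1}) \<and> (\<Sum>n\<in>A. z n n) \<le> (\<Sum>n\<in>A. \<Sum>k\<in>A. \<epsilon> n * \<epsilon> k * z n k)"
  using assms
proof induction
  case empty
  show ?case by (rule exI[of _ "\<lambda>_. 1"]) simp
next
  case (insert a A)
  then obtain \<epsilon> where \<epsilon>: "\<And>n. \<epsilon> n \<in> {-1, 1::real}"
    and le: "(\<Sum>n\<in>A. z n n) \<le> (\<Sum>n\<in>A. \<Sum>k\<in>A. \<epsilon> n * \<epsilon> k * z n k)" by blast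
  define c where "c = (\<Sum>k\<in>A. \<epsilon> k * z a k) + (\<Sum>n\<in>A. \<epsilon> n * z n a)"
  define \<sigma> :: real where "\<sigma> = (if 0 \<le> c then 1 else -1)"
  define \<epsilon>' where "\<epsilon>' = \<epsilon>(a := \<sigma>)"
  have sq: "\<sigma> * \<sigma> = 1" and pos: "0 \<le> \<sigma> * c" by (auto simp: \<sigma>_def)
  have on_A: "\<epsilon>' n = \<epsilon> n" if "n \<in> A" for n using that insert by (auto simp: \<epsilon>'_def)
  have a: "\<epsilon>' a = \<sigma>" by (simp add: \<epsilon>'_def)
  have "(\<Sum>n\<in>insert a A. \<Sum>k\<in>insert a A. \<epsilon>' n * \<epsilon>' k * z n k)
      = \<sigma> * \<sigma> * z a a + (\<Sum>k\<in>A. \<sigma> * (\<epsilon> k * z a k)) + (\<Sum>n\<in>A. \<sigma> * (\<epsilon> n * z n a))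
        + (\<Sum>n\<in>A. \<Sum>k\<in>A. \<epsilon> n * \<epsilon> k * z n k)"
    using insert by (simp add: on_A a sum.distrib mult.assoc mult.left_commute cong: sum.cong)
  also have "\<dots> = z a a + \<sigma> * c + (\<Sum>n\<in>A. \<Sum>k\<in>A. \<epsilon> n * \<epsilon> k * z n k)"
    by (simp add: sq c_def sum_distrib_left distrib_left)
  finally have "(\<Sum>n\<in>insert a A. z n n) \<le> (\<Sum>n\<in>insert a A. \<Sum>k\<in>insert a A. \<epsilon>' n * \<epsilon>' k * z n k)"
    using le pos insert by simp
  moreover have "\<forall>n. \<epsilon>' n \<in> {-1, 1}" using \<epsilon> by (simp add: \<epsilon>'_def \<sigma>_def)
  ultimately show ?case by blast
qed

text \<open>
  A gliding hump selection. Each function \<open>h k\<close> is small at high levels, and fresh functions are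
  arbitrarily small at low levels; choosing the next function to be small wherever the sum so far
  is not, the sum never exceeds the common bound by more than \<open>\<epsilon>\<close>. The labels allow
  choosing functions that belong to different members of a family. The induction needs the
  decay of the sum at high levels as part of its claim.
\<close>

lemma select_small_overlap:
  fixes h :: "'k \<Rightarrow> 'i \<Rightarrow> real" and lev :: "'i \<Rightarrow> nat" and lab :: "'k \<Rightarrow> 'l"
  assumes bound: "\<And>k i. h k i \<le> C" and "0 \<le> C"
    and tail: "\<And>k \<epsilon>. 0 < \<epsilon> \<Longrightarrow> \<exists>m. \<forall>i. m \<le> lev i \<longrightarrow> h k i \<le> \<epsilon>"
    and fresh: "\<And>F m \<epsilon>. finite F \<Longrightarrow> 0 < \<epsilon> \<Longrightarrow>
      \<exists>k. lab k \<notin> lab ` F \<and> (\<forall>i. lev i < m \<longrightarrow> h k i \<le> \<epsilon>)"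
    and "0 < \<epsilon>"
  shows "\<exists>F. finite F \<and> card F = N \<and> inj_on lab F \<and> (\<forall>i. (\<Sum>k\<in>F. h k i) \<le> C + \<epsilon>)"
proof -
  have "\<exists>F. finite F \<and> card F = N \<and> inj_on lab F \<and> (\<forall>i. (\<Sum>k\<in>F. h k i) \<le> C + \<epsilon>) \<and>
      (\<forall>\<delta>>0. \<exists>m. \<forall>i. m \<le> lev i \<longrightarrow> (\<Sum>k\<in>F. h k i) \<le> \<delta>)"
    using \<open>0 < \<epsilon>\<close>
  proof (induction N arbitrary: \<epsilon>)
    case 0
    then show ?case using \<open>0 \<le> C\<close> by (intro exI[of _ "{}"]) auto
  next
    case (Suc N)
    from Suc.IH[of "\<epsilon>/2"] Suc.prems obtain F where F: "finite F" "card F = N" "inj_on lab F"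
      and le: "\<And>i. (\<Sum>k\<in>F. h k i) \<le> C + \<epsilon>/2"
      and tl: "\<And>\<delta>. 0 < \<delta> \<Longrightarrow> \<exists>m. \<forall>i. m \<le> lev i \<longrightarrow> (\<Sum>k\<in>F. h k i) \<le> \<delta>" by auto
    obtain m where m: "\<And>i. m \<le> lev i \<Longrightarrow> (\<Sum>k\<in>F. h k i) \<le> \<epsilon>" using tl[OF Suc.prems] by blast
    obtain k where k: "lab k \<notin> lab ` F" and hk: "\<And>i. lev i < m \<Longrightarrow> h k i \<le> \<epsilon>/2"
      using fresh[OF F(1), of "\<epsilon>/2" m] Suc.prems by auto
    have kF: "k \<notin> F" using k by auto
    have sum: "(\<Sum>l\<in>insert k F. h l i) = h k i + (\<Sum>l\<in>F. h l i)" for i using F kF by simp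
    have "(\<Sum>l\<in>insert k F. h l i) \<le> C + \<epsilon>" for i
    proof (cases "lev i < m")
      case True
      then show ?thesis using hk[of i] le[of i] sum[of i] by simp
    next
      case False
      then show ?thesis using m[of i] bound[of k i] sum[of i] by simp
    qed
    moreover have "\<exists>m. \<forall>i. m \<le> lev i \<longrightarrow> (\<Sum>l\<in>insert k F. h l i) \<le> \<delta>" if "0 < \<delta>" for \<delta>
    proof -
      have "0 < \<delta>/2" using that by simp
      then obtain m1 m2 where "\<forall>i. m1 \<le> lev i \<longrightarrow> (\<Sum>l\<in>F. h l i) \<le> \<delta>/2"
        "\<forall>i. m2 \<le> lev i \<longrightarrow> h k i \<le> \<delta>/2" using tl tail by metis
      then show ?thesis
        unfolding sum by (intro exI[of _ "max m1 m2"]) (metis add_mono field_sum_of_halves max.bounded_iff add.commute)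
    qed
    ultimately show ?case using F kF k by (intro exI[of _ "insert k F"]) auto
  qed
  then show ?thesis by blast
qed

text \<open>
  A choice function with fibres of size at most \<open>M\<close> may be treated as injective at the cost of
  the factor \<open>M\<close>: keep the largest term of every fibre.
\<close>

lemma injective_representatives:
  fixes g :: "'a \<Rightarrow> real"
  assumes "finite A" and nonneg: "\<And>n. n \<in> A \<Longrightarrow> 0 \<le> g n"
    and mult: "\<And>y. card {n \<in> A. j n = y} \<le> M"
  shows "\<exists>A'\<subseteq>A. inj_on j A' \<and> (\<Sum>n\<in>A. g n) \<le> real M * (\<Sum>n\<in>A'. g n)"
proof -
  define fib where "fib y = {n \<in> A. j n = y}" for y
  have fin: "finite (fib y)" for y using \<open>finite A\<close> by (simp add: fib_def)
  have "\<exists>r. r \<in> fib y \<and> (\<forall>n\<in>fib y. g n \<le> g r)" if "y \<in> j ` A" for y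
  proof -
    have "fib y \<noteq> {}" using that by (auto simp: fib_def)
    then have "Max (g ` fib y) \<in> g ` fib y" using fin by simp
    then obtain r where "r \<in> fib y" "Max (g ` fib y) = g r" by blast
    then show ?thesis using fin by (metis Max_ge finite_imageI imageI)
  qed
  then obtain r where r: "\<And>y. y \<in> j ` A \<Longrightarrow> r y \<in> fib y"
    and max: "\<And>y n. y \<in> j ` A \<Longrightarrow> n \<in> fib y \<Longrightarrow> g n \<le> g (r y)" by metis
  have jr: "j (r y) = y" "r y \<in> A" if "y \<in> j ` A" for y using r[OF that] by (auto simp: fib_def)
  have inj: "inj_on r (j ` A)" by (rule inj_on_inverseI[of _ j]) (use jr in auto)
  have "(\<Sum>n\<in>A. g n) = (\<Sum>y\<in>j ` A. \<Sum>n\<in>fib y. g n)"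
    unfolding fib_def by (rule sum.image_gen[OF \<open>finite A\<close>])
  also have "\<dots> \<le> (\<Sum>y\<in>j ` A. real M * g (r y))"
  proof (rule sum_mono)
    fix y assume y: "y \<in> j ` A"
    have "(\<Sum>n\<in>fib y. g n) \<le> real (card (fib y)) * g (r y)"
      using max[OF y] by (intro sum_bounded_above) auto
    also have "\<dots> \<le> real M * g (r y)"
      using mult[of y] nonneg jr(2)[OF y] by (intro mult_right_mono) (auto simp: fib_def)
    finally show "(\<Sum>n\<in>fib y. g n) \<le> real M * g (r y)" .
  qed
  also have "\<dots> = real M * (\<Sum>n\<in>r ` j ` A. g n)"
    by (simp add: sum.reindex[OF inj] sum_distrib_left)
  finally show ?thesis
    using jr by (intro exI[of _ "r ` j ` A"]) (auto intro!: inj_onI)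
qed

text \<open>
  Duality between the Marcinkiewicz and the Lorentz norm: after sorting \<open>c\<close> decreasingly, the
  right-hand sum is \<open>M\<close> times the Lorentz norm of \<open>c\<close>. The bijection is only remembered as an
  injective placement \<open>\<sigma>\<close> of the indices.
\<close>

lemma rearrangement_pairing:
  fixes a c w :: "nat \<Rightarrow> real"
  assumes "finite A" and "0 \<le> M"
    and a: "\<And>B. B \<subseteq> A \<Longrightarrow> (\<Sum>n\<in>B. \<bar>a n\<bar>) \<le> M * (\<Sum>i<card B. w i)"
  shows "\<exists>\<sigma>. inj_on \<sigma> A \<and> (\<Sum>n\<in>A. \<bar>a n * c n\<bar>) \<le> M * (\<Sum>n\<in>A. \<bar>c n\<bar> * w (\<sigma> n))"
proof -
  define xs where "xs = sort_key (\<lambda>n. - \<bar>c n\<bar>) (sorted_list_of_set A)"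
  have xs: "distinct xs" "set xs = A" "length xs = card A"
    using \<open>finite A\<close> by (auto simp: xs_def)
  define d where "d k = \<bar>c (xs ! k)\<bar>" for k
  have dec: "d k \<le> d i" if "i \<le> k" "k < card A" for i k
  proof -
    have "sorted (map (\<lambda>n. - \<bar>c n\<bar>) xs)" unfolding xs_def by (rule sorted_sort_key)
    then have "map (\<lambda>n. - \<bar>c n\<bar>) xs ! i \<le> map (\<lambda>n. - \<bar>c n\<bar>) xs ! k"
      using that xs(3) by (intro sorted_nth_mono) auto
    then show ?thesis using that xs(3) by (simp add: d_def)
  qed
  have bij: "bij_betw (\<lambda>k. xs ! k) {..<card A} A" using xs by (metis bij_betw_nth)
  define u where "u k = M * w k - \<bar>a (xs ! k)\<bar>" for k
  have U: "0 \<le> (\<Sum>k<m. u k)" if "m \<le> card A" for m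
  proof -
    have inj: "inj_on (\<lambda>k. xs ! k) {..<m}"
      using bij that by (meson bij_betw_imp_inj_on inj_on_subset lessThan_subset_iff)
    have sub: "(\<lambda>k. xs ! k) ` {..<m} \<subseteq> A"
      using bij that by (metis bij_betw_imp_surj_on image_mono lessThan_subset_iff)
    show ?thesis
      using a[OF sub] by (simp add: u_def sum_subtractf sum_distrib_left sum.reindex[OF inj] card_image[OF inj])
  qed
  \<comment> \<open>Summation by parts: the weights \<open>d\<close> decrease and the partial sums of \<open>u\<close> are nonnegative.\<close>
  have abel: "d m * (\<Sum>k<Suc m. u k) \<le> (\<Sum>k<Suc m. d k * u k)" if "m < card A" for m
    using that
  proof (induction m)
    case (Suc m)
    have "d (Suc m) * (\<Sum>k<Suc m. u k) \<le> d m * (\<Sum>k<Suc m. u k)"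
      using Suc.prems U[of "Suc m"] dec[of m "Suc m"] by (intro mult_right_mono) auto
    also have "\<dots> \<le> (\<Sum>k<Suc m. d k * u k)" using Suc by simp
    finally show ?case by (simp add: distrib_left)
  qed simp
  have "0 \<le> (\<Sum>k<card A. d k * u k)"
  proof (cases "card A")
    case (Suc m)
    have "0 \<le> d m * (\<Sum>k<Suc m. u k)" using U[of "Suc m"] Suc by (simp add: d_def del: sum.lessThan_Suc)
    then show ?thesis using abel[of m] Suc by (simp del: sum.lessThan_Suc)
  qed simp
  then have main: "(\<Sum>k<card A. \<bar>a (xs ! k) * c (xs ! k)\<bar>) \<le> M * (\<Sum>k<card A. \<bar>c (xs ! k)\<bar> * w k)"
    by (simp add: u_def d_def sum_subtractf sum_distrib_left right_diff_distrib abs_mult mult_ac)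
  define \<sigma> where "\<sigma> = the_inv_into {..<card A} (\<lambda>k. xs ! k)"
  have inv: "bij_betw \<sigma> A {..<card A}" unfolding \<sigma>_def by (rule bij_betw_the_inv_into[OF bij])
  have \<sigma>: "\<sigma> (xs ! k) = k" if "k < card A" for k
    unfolding \<sigma>_def using bij that by (simp add: the_inv_into_f_f bij_betw_def)
  have "(\<Sum>k<card A. \<bar>a (xs ! k) * c (xs ! k)\<bar>) = (\<Sum>n\<in>A. \<bar>a n * c n\<bar>)"
    by (rule sum.reindex_bij_betw[OF bij])
  moreover have "(\<Sum>n\<in>A. \<bar>c n\<bar> * w (\<sigma> n)) = (\<Sum>k<card A. \<bar>c (xs ! k)\<bar> * w k)"
    by (subst sum.reindex_bij_betw[OF bij, symmetric]) (simp add: \<sigma>)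
  ultimately show ?thesis using main inv by (metis bij_betw_imp_inj_on)
qed


section \<open>Greedy bases of a seminormed subspace\<close>

locale seminormed_carrier =
  fixes V :: "'v::real_vector set" and nrm :: "'v \<Rightarrow> real"
  assumes subspace: "subspace V"
    and nonneg: "v \<in> V \<Longrightarrow> 0 \<le> nrm v"
    and triangle: "\<lbrakk>u \<in> V; v \<in> V\<rbrakk> \<Longrightarrow> nrm (u + v) \<le> nrm u + nrm v"
    and scale: "v \<in> V \<Longrightarrow> nrm (c *\<^sub>R v) = \<bar>c\<bar> * nrm v"
begin

lemma carrier_closed [intro]:
  "0 \<in> V" "\<lbrakk>u \<in> V; v \<in> V\<rbrakk> \<Longrightarrow> u + v \<in> V" "\<lbrakk>u \<in> V; v \<in> V\<rbrakk> \<Longrightarrow> u - v \<in> V"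
  "v \<in> V \<Longrightarrow> c *\<^sub>R v \<in> V"
  using subspace by (auto simp: subspace_0 subspace_add subspace_diff subspace_scale)

lemma sum_closed [intro]: "(\<And>i. i \<in> A \<Longrightarrow> f i \<in> V) \<Longrightarrow> (\<Sum>i\<in>A. f i) \<in> V"
  using subspace by (rule subspace_sum)

lemma zero [simp]: "nrm 0 = 0"
  using scale[of 0 0] carrier_closed(1) by simp

lemma minus: "v \<in> V \<Longrightarrow> nrm (- v) = nrm v"
  using scale[of v "-1"] by simp

lemma triangle_diff: "\<lbrakk>u \<in> V; v \<in> V\<rbrakk> \<Longrightarrow> nrm (u - v) \<le> nrm u + nrm v"
  using triangle[of u "- v"] minus[of v] carrier_closed(4)[of v "-1"] by simp

text \<open>
  By convexity: multipliers in the cube \<open>[-1, 1]^A\<close> are convex combinations of sign patterns.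
\<close>

lemma norm_signs_imp_norm_multipliers:
  fixes A :: "'i set"
  assumes "finite A" and y: "\<And>n. n \<in> A \<Longrightarrow> y n \<in> V" and "u \<in> V"
    and signs: "\<And>\<epsilon>. (\<forall>n. \<epsilon> n \<in> {-1, 1}) \<Longrightarrow> nrm (u + (\<Sum>n\<in>A. \<epsilon> n *\<^sub>R y n)) \<le> R"
    and \<theta>: "\<And>n. n \<in> A \<Longrightarrow> \<bar>\<theta> n\<bar> \<le> 1"
  shows "nrm (u + (\<Sum>n\<in>A. \<theta> n *\<^sub>R y n)) \<le> R"
  using assms
proof (induction A arbitrary: u)
  case empty
  then show ?case using empty.prems(3)[of "\<lambda>_. 1"] by simp
next
  case (insert k A)
  define S where "S = (\<Sum>n\<in>A. \<theta> n *\<^sub>R y n)"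
  have yk: "y k \<in> V" and S: "S \<in> V" using insert.prems unfolding S_def by blast+
  have step: "nrm ((u + \<sigma> *\<^sub>R y k) + S) \<le> R" if "\<sigma> \<in> {-1, 1}" for \<sigma>
    unfolding S_def
  proof (rule insert.IH)
    fix \<epsilon> :: "'i \<Rightarrow> real" assume \<epsilon>: "\<forall>n. \<epsilon> n \<in> {-1, 1}"
    have "(\<Sum>n\<in>A. (\<epsilon>(k := \<sigma>)) n *\<^sub>R y n) = (\<Sum>n\<in>A. \<epsilon> n *\<^sub>R y n)"
      using insert.hyps by (intro sum.cong) auto
    then show "nrm ((u + \<sigma> *\<^sub>R y k) + (\<Sum>n\<in>A. \<epsilon> n *\<^sub>R y n)) \<le> R"
      using insert.prems(3)[of "\<epsilon>(k := \<sigma>)"] insert.hyps \<epsilon> that by (simp add: add.assoc)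
  qed (use insert.prems yk in auto)
  define t where "t = (1 + \<theta> k) / 2"
  have t: "0 \<le> t" "t \<le> 1" and \<theta>k: "\<theta> k = 2 * t - 1"
    using insert.prems(4)[of k] by (auto simp: t_def field_simps)
  have twice: "(t * 2) *\<^sub>R y k = t *\<^sub>R y k + t *\<^sub>R y k"
    by (simp add: scaleR_left_distrib[symmetric])
  have "u + (\<Sum>n\<in>insert k A. \<theta> n *\<^sub>R y n)
      = t *\<^sub>R ((u + 1 *\<^sub>R y k) + S) + (1 - t) *\<^sub>R ((u + (-1) *\<^sub>R y k) + S)"
    using insert.hyps by (simp add: S_def[symmetric] \<theta>k algebra_simps twice)
  also have "nrm \<dots> \<le> t * nrm ((u + 1 *\<^sub>R y k) + S) + (1 - t) * nrm ((u + (-1) *\<^sub>R y k) + S)"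
  proof -
    have "(u + 1 *\<^sub>R y k) + S \<in> V" "(u + (-1) *\<^sub>R y k) + S \<in> V"
      using insert.prems(2) yk S by blast+
    then show ?thesis using t by (intro order_trans[OF triangle]) (auto simp: scale)
  qed
  also have "\<dots> \<le> t * R + (1 - t) * R"
    using step[of 1] step[of "-1"] t by (intro add_mono mult_left_mono) auto
  finally show ?case by (simp add: algebra_simps)
qed

lemma best_approx_error_le:
  assumes "v \<in> V" "\<And>n. x n \<in> V" "finite A"
  shows "best_approx_error nrm x v (card A) \<le> nrm (v - (\<Sum>n\<in>A. \<alpha> n *\<^sub>R x n))"
  unfolding best_approx_error_def
proof (rule cInf_lower)
  show "bdd_below {nrm (v - (\<Sum>n\<in>B. \<alpha> n *\<^sub>R x n)) |B \<alpha>. finite B \<and> card B = card A}"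
    using assms(1,2) by (intro bdd_belowI[of _ 0]) (auto intro!: nonneg)
qed (use assms in blast)

lemma best_approx_error_greatest:
  assumes "\<And>A \<alpha>. finite A \<Longrightarrow> card A = N \<Longrightarrow> B \<le> nrm (v - (\<Sum>n\<in>A. \<alpha> n *\<^sub>R x n))"
  shows "B \<le> best_approx_error nrm x v N"
  unfolding best_approx_error_def
proof (rule cInf_greatest)
  show "{nrm (v - (\<Sum>n\<in>A. \<alpha> n *\<^sub>R x n)) |A \<alpha>. finite A \<and> card A = N} \<noteq> {}"
    using card_lessThan[of N] by (metis (mono_tags, lifting) empty_Collect_eq finite_lessThan)
qed (use assms in auto)

end

locale greedy_with_constant = seminormed_carrier V nrm
  for V :: "'v::real_vector set" and nrm +
  fixes x :: "nat \<Rightarrow> 'v" and C :: real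
  assumes basis: "schauder_basis V nrm x" and seminormalized: "semi_normalized nrm x"
    and C_ge_1: "1 \<le> C"
    and greedy: "\<lbrakk>v \<in> V; finite \<Lambda>;
      \<And>n m. \<lbrakk>n \<in> \<Lambda>; m \<notin> \<Lambda>\<rbrakk> \<Longrightarrow> \<bar>basis_coeff nrm x v m\<bar> \<le> \<bar>basis_coeff nrm x v n\<bar>\<rbrakk> \<Longrightarrow>
      nrm (v - (\<Sum>n\<in>\<Lambda>. basis_coeff nrm x v n *\<^sub>R x n)) \<le> C * best_approx_error nrm x v (card \<Lambda>)"
begin

abbreviation coeff where "coeff \<equiv> basis_coeff nrm x"

text \<open>
  The unconditionality constant: \<open>1 + C\<close> bounds the projections, and changing signs takes two.
\<close>

definition K :: real where "K = 2 * (1 + C)"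

lemma K_pos: "0 < K"
  using C_ge_1 by (simp add: K_def)

lemma x_in [simp, intro]: "x n \<in> V"
  using basis by (simp add: schauder_basis_def)

lemma expands_coeff: "v \<in> V \<Longrightarrow> expands nrm x v (coeff v)"
  unfolding basis_coeff_def by (rule theI'[of "expands nrm x v"]) (use basis in \<open>simp add: schauder_basis_def\<close>)

lemma coeff_eqI: "\<lbrakk>v \<in> V; expands nrm x v a\<rbrakk> \<Longrightarrow> coeff v = a"
  using basis expands_coeff by (auto simp: schauder_basis_def)

text \<open>
  The remainders of the sum of two expansions tend to \<open>0\<close> by the triangle inequality, so linearity
  follows from uniqueness.
\<close>

lemma coeff_add_scaleR:
  assumes "u \<in> V" "v \<in> V"
  shows "coeff (u + c *\<^sub>R v) n = coeff u n + c * coeff v n"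
proof -
  let ?r = "\<lambda>v m. v - (\<Sum>n<m. coeff v n *\<^sub>R x n)"
  have r: "?r v m \<in> V" if "v \<in> V" for v m using that by blast
  have lim: "(\<lambda>m. nrm (?r u m) + \<bar>c\<bar> * nrm (?r v m)) \<longlonglongrightarrow> 0 + \<bar>c\<bar> * 0"
    using expands_coeff assms unfolding expands_def by (intro tendsto_intros) auto
  have eq: "u + c *\<^sub>R v - (\<Sum>n<m. (coeff u n + c * coeff v n) *\<^sub>R x n) = ?r u m + c *\<^sub>R ?r v m" for m
    by (simp add: scaleR_left_distrib scaleR_right_diff_distrib scaleR_sum_right sum.distrib)
  have "expands nrm x (u + c *\<^sub>R v) (\<lambda>n. coeff u n + c * coeff v n)"
    unfolding expands_def eq
  proof (rule tendsto_sandwich[OF _ _ tendsto_const])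
    show "(\<lambda>m. nrm (?r u m) + \<bar>c\<bar> * nrm (?r v m)) \<longlonglongrightarrow> 0" using lim by simp
    show "\<forall>\<^sub>F m in sequentially. 0 \<le> nrm (?r u m + c *\<^sub>R ?r v m)"
      using r assms by (intro always_eventually allI nonneg) blast
    show "\<forall>\<^sub>F m in sequentially. nrm (?r u m + c *\<^sub>R ?r v m) \<le> nrm (?r u m) + \<bar>c\<bar> * nrm (?r v m)"
      using r assms by (intro always_eventually allI order_trans[OF triangle]) (auto simp: scale)
  qed
  then show ?thesis using coeff_eqI[of "u + c *\<^sub>R v"] assms by (auto simp: carrier_closed)
qed

lemma coeff_sum:
  assumes "finite A" "\<And>i. i \<in> A \<Longrightarrow> v i \<in> V"
  shows "coeff (\<Sum>i\<in>A. c i *\<^sub>R v i) n = (\<Sum>i\<in>A. c i * coeff (v i) n)"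
  using assms
proof (induction A)
  case empty
  have "coeff (0 + (-1) *\<^sub>R 0) n = coeff 0 n + (-1) * coeff 0 n"
    by (rule coeff_add_scaleR) auto
  then show ?case by simp
next
  case (insert a A)
  have "coeff ((\<Sum>i\<in>A. c i *\<^sub>R v i) + c a *\<^sub>R v a) n = coeff (\<Sum>i\<in>A. c i *\<^sub>R v i) n + c a * coeff (v a) n"
    using insert.prems by (intro coeff_add_scaleR) auto
  then show ?case using insert by (simp add: add.commute)
qed

lemma coeff_finite_combination:
  assumes "finite A"
  shows "coeff (\<Sum>n\<in>A. a n *\<^sub>R x n) m = (if m \<in> A then a m else 0)"
proof -
  let ?b = "\<lambda>n. if n \<in> A then a n else 0"
  obtain M where M: "A \<subseteq> {..<M}" using assms finite_nat_iff_bounded by blast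
  have "(\<Sum>n<m. ?b n *\<^sub>R x n) = (\<Sum>n\<in>A. a n *\<^sub>R x n)" if "m \<ge> M" for m
    using that M assms by (intro sum.mono_neutral_cong_right) auto
  then have "\<forall>\<^sub>F m in sequentially. nrm ((\<Sum>n\<in>A. a n *\<^sub>R x n) - (\<Sum>n<m. ?b n *\<^sub>R x n)) = 0"
    by (intro eventually_sequentiallyI[of M]) simp
  then have "expands nrm x (\<Sum>n\<in>A. a n *\<^sub>R x n) ?b"
    unfolding expands_def by (rule tendsto_eventually)
  then have "coeff (\<Sum>n\<in>A. a n *\<^sub>R x n) = ?b" by (intro coeff_eqI) auto
  then show ?thesis by (simp only:)
qed

lemma norm_x_lower: "\<exists>l>0. \<forall>n. l \<le> nrm (x n)"
proof (intro exI conjI allI)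
  show "0 < (INF n. nrm (x n))" using seminormalized by (simp add: semi_normalized_def)
  fix n show "(INF n. nrm (x n)) \<le> nrm (x n)"
    by (intro cINF_lower bdd_belowI[of _ 0]) (auto intro: nonneg)
qed

lemma norm_x_upper: "\<exists>u>0. \<forall>n. nrm (x n) \<le> u"
proof -
  obtain u where "\<And>n. nrm (x n) \<le> u"
    using seminormalized by (auto simp: semi_normalized_def bdd_above_def)
  then show ?thesis by (intro exI[of _ "max u 1"]) (auto simp: le_max_iff_disj)
qed

text \<open>
  The terms of a norm convergent expansion tend to \<open>0\<close>, and the basis vectors are bounded away
  from \<open>0\<close>.
\<close>

lemma coeff_tendsto_0:
  assumes "v \<in> V"
  shows "coeff v \<longlonglongrightarrow> 0"
proof -
  obtain l where l: "0 < l" "\<And>n. l \<le> nrm (x n)" using norm_x_lower by blast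
  let ?r = "\<lambda>m. v - (\<Sum>n<m. coeff v n *\<^sub>R x n)"
  have r: "?r m \<in> V" for m using assms by blast
  have lim: "(\<lambda>m. nrm (?r m)) \<longlonglongrightarrow> 0" using expands_coeff[OF assms] by (simp add: expands_def)
  have "(\<lambda>m. (nrm (?r m) + nrm (?r (Suc m))) / l) \<longlonglongrightarrow> (0 + 0) / l"
    using LIMSEQ_Suc[OF lim] lim l(1) by (intro tendsto_intros) auto
  moreover have "norm (coeff v m) \<le> (nrm (?r m) + nrm (?r (Suc m))) / l" for m
  proof -
    have "\<bar>coeff v m\<bar> * l \<le> \<bar>coeff v m\<bar> * nrm (x m)" using l by (intro mult_left_mono) auto
    also have "\<dots> = nrm (?r m - ?r (Suc m))" by (simp add: scale)
    also have "\<dots> \<le> nrm (?r m) + nrm (?r (Suc m))" by (intro triangle_diff r)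
    finally show ?thesis using l(1) by (simp add: pos_le_divide_eq)
  qed
  ultimately show ?thesis
    by (intro Lim_null_comparison[where f = "coeff v"] always_eventually) auto
qed

text \<open>
  Raise the coefficients on \<open>A\<close> to a value \<open>b\<close> that dominates all others, giving \<open>g\<close>. Then
  \<open>A\<close> is a greedy set of \<open>g\<close>, the greedy remainder is \<open>v\<close> without its part on \<open>A\<close>, and \<open>v\<close>
  itself is an admissible competitor.
\<close>

lemma norm_projection_le:
  assumes "v \<in> V" "finite A"
  shows "nrm (\<Sum>n\<in>A. coeff v n *\<^sub>R x n) \<le> (1 + C) * nrm v"
proof -
  obtain b where b: "\<And>n. \<bar>coeff v n\<bar> \<le> b"
    using convergent_imp_Bseq[OF convergentI[OF coeff_tendsto_0[OF assms(1)]]]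
    by (auto simp: Bseq_def)
  define P where "P = (\<Sum>n\<in>A. coeff v n *\<^sub>R x n)"
  define g where "g = v + (\<Sum>n\<in>A. (b - coeff v n) *\<^sub>R x n)"
  have P: "P \<in> V" and g: "g \<in> V" using assms by (auto simp: P_def g_def)
  have "(\<Sum>n\<in>A. (b - coeff v n) *\<^sub>R x n) \<in> V" by auto
  then have cg: "coeff g m = (if m \<in> A then b else coeff v m)" for m
    using coeff_add_scaleR[of v "\<Sum>n\<in>A. (b - coeff v n) *\<^sub>R x n" 1 m] assms
    by (simp add: g_def coeff_finite_combination)
  have g_eq: "g = v - P + (\<Sum>n\<in>A. b *\<^sub>R x n)"
    by (simp add: g_def P_def scaleR_left_diff_distrib sum_subtractf)
  have "0 \<le> b" using b[of 0] by simp
  have "nrm (g - (\<Sum>n\<in>A. coeff g n *\<^sub>R x n)) \<le> C * best_approx_error nrm x g (card A)"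
    using b \<open>0 \<le> b\<close> by (intro greedy[OF g assms(2)]) (simp add: cg)
  also have "best_approx_error nrm x g (card A) \<le> nrm (g - (\<Sum>n\<in>A. (b - coeff v n) *\<^sub>R x n))"
    using g assms by (intro best_approx_error_le) auto
  finally have "nrm (g - (\<Sum>n\<in>A. coeff g n *\<^sub>R x n)) \<le> C * nrm v"
    using C_ge_1 by (simp add: g_def mult_left_mono)
  moreover have "(\<Sum>n\<in>A. coeff g n *\<^sub>R x n) = (\<Sum>n\<in>A. b *\<^sub>R x n)"
    by (intro sum.cong) (auto simp: cg)
  then have "g - (\<Sum>n\<in>A. coeff g n *\<^sub>R x n) = v - P"
    by (simp add: g_eq)
  ultimately have "nrm (v - P) \<le> C * nrm v" by simp
  moreover have "nrm (v - (v - P)) \<le> nrm v + nrm (v - P)"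
    using assms P by (intro triangle_diff) auto
  ultimately show ?thesis by (simp add: P_def[symmetric] algebra_simps)
qed

text \<open>
  Unconditionality: a sign pattern is the difference of two projections, and signs suffice.
\<close>

lemma norm_multiplier_le:
  assumes "v \<in> V" "finite A" "\<And>n. n \<in> A \<Longrightarrow> \<bar>\<theta> n\<bar> \<le> 1"
  shows "nrm (\<Sum>n\<in>A. (\<theta> n * coeff v n) *\<^sub>R x n) \<le> K * nrm v"
proof -
  have "nrm (0 + (\<Sum>n\<in>A. \<theta> n *\<^sub>R (coeff v n *\<^sub>R x n))) \<le> K * nrm v"
  proof (rule norm_signs_imp_norm_multipliers)
    fix \<epsilon> :: "nat \<Rightarrow> real" assume \<epsilon>: "\<forall>n. \<epsilon> n \<in> {-1, 1}"
    define P where "P = {n \<in> A. \<epsilon> n = 1}"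
    have fin: "finite P" "finite (A - P)" using assms(2) by (auto simp: P_def)
    have sub: "P \<subseteq> A" by (auto simp: P_def)
    have "(\<Sum>n\<in>A. \<epsilon> n *\<^sub>R (coeff v n *\<^sub>R x n))
        = (\<Sum>n\<in>A - P. \<epsilon> n *\<^sub>R (coeff v n *\<^sub>R x n)) + (\<Sum>n\<in>P. \<epsilon> n *\<^sub>R (coeff v n *\<^sub>R x n))"
      by (rule sum.subset_diff[OF sub assms(2)])
    also have "\<dots> = (\<Sum>n\<in>A - P. - (coeff v n *\<^sub>R x n)) + (\<Sum>n\<in>P. coeff v n *\<^sub>R x n)"
    proof -
      have "\<epsilon> n *\<^sub>R (coeff v n *\<^sub>R x n) = - (coeff v n *\<^sub>R x n)" if "n \<in> A - P" for n
      proof -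
        have "\<epsilon> n = -1" using \<epsilon> that by (force simp: P_def)
        then show ?thesis by simp
      qed
      moreover have "\<epsilon> n *\<^sub>R (coeff v n *\<^sub>R x n) = coeff v n *\<^sub>R x n" if "n \<in> P" for n
        using that by (simp add: P_def)
      ultimately show ?thesis by (intro arg_cong2[where f = "(+)"] sum.cong refl)
    qed
    also have "\<dots> = (\<Sum>n\<in>P. coeff v n *\<^sub>R x n) - (\<Sum>n\<in>A - P. coeff v n *\<^sub>R x n)"
      by (simp add: sum_negf)
    also have "nrm \<dots> \<le> (1 + C) * nrm v + (1 + C) * nrm v"
      by (intro order_trans[OF triangle_diff] add_mono norm_projection_le assms fin) auto
    finally show "nrm (0 + (\<Sum>n\<in>A. \<epsilon> n *\<^sub>R (coeff v n *\<^sub>R x n))) \<le> K * nrm v"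
      by (simp add: K_def algebra_simps)
  qed (use assms in auto)
  then show ?thesis by simp
qed

lemma norm_combination_mono:
  assumes "finite A" "B \<subseteq> A" "\<And>n. n \<in> B \<Longrightarrow> \<bar>b n\<bar> \<le> \<bar>a n\<bar>"
  shows "nrm (\<Sum>n\<in>B. b n *\<^sub>R x n) \<le> K * nrm (\<Sum>n\<in>A. a n *\<^sub>R x n)"
proof -
  have "nrm (\<Sum>n\<in>B. ((b n / a n) * coeff (\<Sum>n\<in>A. a n *\<^sub>R x n) n) *\<^sub>R x n) \<le> K * nrm (\<Sum>n\<in>A. a n *\<^sub>R x n)"
  proof (rule norm_multiplier_le)
    show "finite B" using assms finite_subset by blast
    show "\<bar>b n / a n\<bar> \<le> 1" if "n \<in> B" for n
      using assms(3)[OF that] by (cases "a n = 0") (auto simp: divide_simps)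
  qed auto
  moreover have "(b n / a n) * coeff (\<Sum>n\<in>A. a n *\<^sub>R x n) n = b n" if "n \<in> B" for n
    using assms(2) assms(3)[OF that] that
    by (cases "a n = 0") (auto simp: coeff_finite_combination[OF assms(1)])
  ultimately show ?thesis by (simp cong: sum.cong)
qed

lemma coeff_bounded: "\<exists>L>0. \<forall>v\<in>V. \<forall>n. \<bar>coeff v n\<bar> \<le> L * nrm v"
proof -
  obtain l where l: "0 < l" "\<And>n. l \<le> nrm (x n)" using norm_x_lower by blast
  have "\<bar>coeff v n\<bar> \<le> K / l * nrm v" if "v \<in> V" for v n
  proof -
    have "\<bar>coeff v n\<bar> * l \<le> \<bar>coeff v n\<bar> * nrm (x n)" using l by (intro mult_left_mono) auto
    also have "\<dots> = nrm (\<Sum>n\<in>{n}. (1 * coeff v n) *\<^sub>R x n)" by (simp add: scale)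
    also have "\<dots> \<le> K * nrm v" using that by (intro norm_multiplier_le) auto
    finally show ?thesis using l(1) by (simp add: field_simps)
  qed
  then show ?thesis using l K_pos by (intro exI[of _ "K / l"]) auto
qed

text \<open>
  In \<open>\<Sum>n\<in>A \<union> B. x n\<close> all coefficients agree, so \<open>B\<close> is a greedy set; removing \<open>A\<close> is an
  approximation with the same number of terms.
\<close>

lemma norm_disjoint_sum_le:
  assumes "finite A" "finite B" "A \<inter> B = {}" "card A = card B"
  shows "nrm (\<Sum>n\<in>A. x n) \<le> C * nrm (\<Sum>n\<in>B. x n)"
proof -
  define g where "g = (\<Sum>n\<in>A \<union> B. 1 *\<^sub>R x n)"
  have g: "g \<in> V" by (auto simp: g_def)
  have cg: "coeff g m = (if m \<in> A \<union> B then 1 else 0)" for m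
    unfolding g_def using assms by (subst coeff_finite_combination) auto
  have g_eq: "g = (\<Sum>n\<in>A. x n) + (\<Sum>n\<in>B. x n)"
    using assms by (simp add: g_def sum.union_disjoint)
  have "nrm (g - (\<Sum>n\<in>B. coeff g n *\<^sub>R x n)) \<le> C * best_approx_error nrm x g (card B)"
    using assms by (intro greedy[OF g]) (auto simp: cg)
  also have "best_approx_error nrm x g (card B) \<le> nrm (g - (\<Sum>n\<in>A. 1 *\<^sub>R x n))"
    using best_approx_error_le[of g x A "\<lambda>_. 1"] g assms by simp
  finally have "nrm (g - (\<Sum>n\<in>B. coeff g n *\<^sub>R x n)) \<le> C * nrm (g - (\<Sum>n\<in>A. 1 *\<^sub>R x n))"
    using C_ge_1 by (simp add: mult_left_mono)
  moreover have "(\<Sum>n\<in>B. coeff g n *\<^sub>R x n) = (\<Sum>n\<in>B. x n)"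
    by (intro sum.cong) (auto simp: cg)
  ultimately show ?thesis by (simp add: g_eq)
qed

text \<open>
  Overlapping sets are compared through a third set disjoint from both.
\<close>

lemma democratic:
  assumes "finite A" "finite B" "card A \<le> card B"
  shows "nrm (\<Sum>n\<in>A. x n) \<le> C * C * K * nrm (\<Sum>n\<in>B. x n)"
proof -
  obtain B' where B': "B' \<subseteq> B" "card B' = card A" "finite B'"
    using obtain_subset_with_card_n[OF assms(3)] by metis
  obtain M where M: "A \<union> B \<subseteq> {..<M}" using assms finite_nat_iff_bounded by blast
  \<comment> \<open>The auxiliary set lies beyond both \<open>A\<close> and \<open>B\<close>.\<close>
  define D where "D = {M..<M + card A}"
  have D: "finite D" "card D = card A" "A \<inter> D = {}" "D \<inter> B' = {}"
    using M B' by (auto simp: D_def)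
  have "nrm (\<Sum>n\<in>A. x n) \<le> C * nrm (\<Sum>n\<in>D. x n)"
    using assms D by (intro norm_disjoint_sum_le) auto
  also have "\<dots> \<le> C * (C * nrm (\<Sum>n\<in>B'. x n))"
    using D B' C_ge_1 by (intro mult_left_mono norm_disjoint_sum_le) auto
  also have "\<dots> \<le> C * (C * (K * nrm (\<Sum>n\<in>B. x n)))"
    using norm_combination_mono[OF assms(2) B'(1), of "\<lambda>_. 1" "\<lambda>_. 1"] C_ge_1
    by (intro mult_left_mono) auto
  finally show ?thesis by (simp add: mult.assoc)
qed

text \<open>
  The functionals \<open>x_n*\<close> are tested on vectors \<open>v n\<close> whose signed sums are bounded. With suitable
  signs, the sum of the diagonal terms \<open>f (x n) * coeff (v n) n\<close> is at most the value of \<open>f\<close> at a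
  vector obtained from a signed sum of the \<open>v n\<close> by restricting its expansion to \<open>A\<close> and changing
  signs; unconditionality bounds the norm of that vector.
\<close>

lemma functional_test_vectors:
  assumes "finite A" and v: "\<And>n. n \<in> A \<Longrightarrow> v n \<in> V" and "linear f"
    and f: "\<And>y. y \<in> V \<Longrightarrow> f y \<le> F * nrm y" and "0 \<le> F"
    and signs: "\<And>\<epsilon>. (\<forall>n. \<bar>\<epsilon> n\<bar> = 1) \<Longrightarrow> nrm (\<Sum>n\<in>A. \<epsilon> n *\<^sub>R v n) \<le> R"
  shows "(\<Sum>n\<in>A. \<bar>f (x n) * coeff (v n) n\<bar>) \<le> F * (K * R)"
proof -
  define \<theta> :: "nat \<Rightarrow> real" where "\<theta> k = (if 0 \<le> f (x k) * coeff (v k) k then 1 else -1)" for k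
  obtain \<epsilon> where \<epsilon>: "\<And>n. \<epsilon> n \<in> {-1, 1::real}"
    and le: "(\<Sum>n\<in>A. \<theta> n * (f (x n) * coeff (v n) n))
      \<le> (\<Sum>n\<in>A. \<Sum>k\<in>A. \<epsilon> n * \<epsilon> k * (\<theta> k * (f (x n) * coeff (v k) n)))"
    using signs_dominate_diagonal[OF assms(1), of "\<lambda>n k. \<theta> k * (f (x n) * coeff (v k) n)"] by blast
  define u where "u = (\<Sum>k\<in>A. (\<epsilon> k * \<theta> k) *\<^sub>R v k)"
  have abs\<epsilon>: "\<bar>\<epsilon> n\<bar> = 1" for n using \<epsilon>[of n] by auto
  have u: "u \<in> V" using v by (auto simp: u_def)
  have nu: "nrm u \<le> R" unfolding u_def by (rule signs) (simp add: abs_mult abs\<epsilon> \<theta>_def)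
  have cu: "coeff u n = (\<Sum>k\<in>A. \<epsilon> k * \<theta> k * coeff (v k) n)" for n
    unfolding u_def using assms(1) v by (rule coeff_sum)
  have "(\<Sum>n\<in>A. \<bar>f (x n) * coeff (v n) n\<bar>) = (\<Sum>n\<in>A. \<theta> n * (f (x n) * coeff (v n) n))"
    by (intro sum.cong) (auto simp: \<theta>_def)
  also have "\<dots> \<le> (\<Sum>n\<in>A. \<epsilon> n * coeff u n * f (x n))"
    using le by (simp add: cu sum_distrib_left sum_distrib_right mult_ac)
  also have "\<dots> = f (\<Sum>n\<in>A. (\<epsilon> n * coeff u n) *\<^sub>R x n)"
    using \<open>linear f\<close> by (simp add: linear_sum linear_scale)
  also have "\<dots> \<le> F * nrm (\<Sum>n\<in>A. (\<epsilon> n * coeff u n) *\<^sub>R x n)" by (rule f) auto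
  also have "\<dots> \<le> F * (K * nrm u)"
    using assms(1) u abs\<epsilon> \<open>0 \<le> F\<close> by (intro mult_left_mono norm_multiplier_le) auto
  also have "\<dots> \<le> F * (K * R)" using nu K_pos \<open>0 \<le> F\<close> by (intro mult_left_mono) auto
  finally show ?thesis .
qed

text \<open>
  The counterpart for a combination of the \<open>x n\<close>, tested on functionals \<open>f n\<close> whose signed sums
  are bounded.
\<close>

lemma combination_test_functionals:
  assumes "finite A" "A' \<subseteq> A" and f: "\<And>n. linear (f n)" and "0 \<le> F"
    and signs: "\<And>\<epsilon> y. \<lbrakk>y \<in> V; \<forall>n. \<bar>\<epsilon> n\<bar> = 1\<rbrakk> \<Longrightarrow> (\<Sum>n\<in>A'. \<epsilon> n * f n y) \<le> F * nrm y"
  shows "(\<Sum>n\<in>A'. \<bar>a n * f n (x n)\<bar>) \<le> F * (K * nrm (\<Sum>n\<in>A. a n *\<^sub>R x n))"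
proof -
  define \<theta> :: "nat \<Rightarrow> real" where "\<theta> k = (if 0 \<le> a k * f k (x k) then 1 else -1)" for k
  have fin: "finite A'" using assms finite_subset by blast
  obtain \<epsilon> where \<epsilon>: "\<And>n. \<epsilon> n \<in> {-1, 1::real}"
    and le: "(\<Sum>n\<in>A'. \<theta> n * (a n * f n (x n)))
      \<le> (\<Sum>n\<in>A'. \<Sum>k\<in>A'. \<epsilon> n * \<epsilon> k * (\<theta> n * (a k * f n (x k))))"
    using signs_dominate_diagonal[OF fin, of "\<lambda>n k. \<theta> n * (a k * f n (x k))"] by blast
  have abs\<epsilon>: "\<bar>\<epsilon> n\<bar> = 1" for n using \<epsilon>[of n] by auto
  define y where "y = (\<Sum>k\<in>A'. (\<epsilon> k * a k) *\<^sub>R x k)"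
  have fy: "f n y = (\<Sum>k\<in>A'. \<epsilon> k * a k * f n (x k))" for n
    using f[of n] by (simp add: y_def linear_sum linear_scale)
  have "(\<Sum>n\<in>A'. \<bar>a n * f n (x n)\<bar>) = (\<Sum>n\<in>A'. \<theta> n * (a n * f n (x n)))"
    by (intro sum.cong) (auto simp: \<theta>_def)
  also have "\<dots> \<le> (\<Sum>n\<in>A'. (\<epsilon> n * \<theta> n) * f n y)"
    using le by (simp add: fy sum_distrib_left sum_distrib_right mult_ac)
  also have "\<dots> \<le> F * nrm y"
    by (rule signs) (auto simp: y_def abs_mult abs\<epsilon> \<theta>_def)
  also have "\<dots> \<le> F * (K * nrm (\<Sum>n\<in>A. a n *\<^sub>R x n))"
    unfolding y_def using assms(1,2,4)
    by (intro mult_left_mono norm_combination_mono) (auto simp: abs_mult abs\<epsilon>)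
  finally show ?thesis .
qed

end

lemma (in seminormed_carrier) greedy_basis_imp_constant:
  assumes "greedy_basis V nrm x"
  shows "\<exists>C. greedy_with_constant V nrm x C"
proof -
  obtain C0 where C0: "\<And>v \<Lambda>. \<lbrakk>v \<in> V; finite \<Lambda>;
      \<forall>n\<in>\<Lambda>. \<forall>m\<in>-\<Lambda>. \<bar>basis_coeff nrm x v m\<bar> \<le> \<bar>basis_coeff nrm x v n\<bar>\<rbrakk> \<Longrightarrow>
      nrm (v - (\<Sum>n\<in>\<Lambda>. basis_coeff nrm x v n *\<^sub>R x n)) \<le> C0 * best_approx_error nrm x v (card \<Lambda>)"
    using assms unfolding greedy_basis_def by metis
  have x: "x n \<in> V" for n using assms by (simp add: greedy_basis_def schauder_basis_def)
  have err: "0 \<le> best_approx_error nrm x v N" if "v \<in> V" for v N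
    using that x by (intro best_approx_error_greatest nonneg) auto
  have "greedy_with_constant V nrm x (max 1 C0)"
  proof
    fix v \<Lambda> assume "v \<in> V" "finite \<Lambda>"
      "\<And>n m. \<lbrakk>n \<in> \<Lambda>; m \<notin> \<Lambda>\<rbrakk> \<Longrightarrow> \<bar>basis_coeff nrm x v m\<bar> \<le> \<bar>basis_coeff nrm x v n\<bar>"
    then have "nrm (v - (\<Sum>n\<in>\<Lambda>. basis_coeff nrm x v n *\<^sub>R x n)) \<le> C0 * best_approx_error nrm x v (card \<Lambda>)"
      by (intro C0) auto
    also have "\<dots> \<le> max 1 C0 * best_approx_error nrm x v (card \<Lambda>)"
      using err \<open>v \<in> V\<close> by (intro mult_right_mono) auto
    finally show "nrm (v - (\<Sum>n\<in>\<Lambda>. basis_coeff nrm x v n *\<^sub>R x n))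
      \<le> max 1 C0 * best_approx_error nrm x v (card \<Lambda>)" .
  qed (use assms in \<open>auto simp: greedy_basis_def\<close>)
  then show ?thesis by blast
qed


section \<open>The Marcinkiewicz norm through finite sets\<close>

lemma finite_abs_ge:
  fixes a :: "nat \<Rightarrow> real"
  assumes "a \<longlonglongrightarrow> 0" "0 < t"
  shows "finite {i. t \<le> \<bar>a i\<bar>}"
proof -
  obtain m where m: "\<And>i. m \<le> i \<Longrightarrow> norm (a i - 0) < t" using LIMSEQ_D[OF assms] by blast
  have "i < m" if "t \<le> \<bar>a i\<bar>" for i
    using m[of i] that by (cases "i < m") auto
  then have "{i. t \<le> \<bar>a i\<bar>} \<subseteq> {..<m}" by blast
  then show ?thesis using finite_subset by blast
qed

lemma abs_max_off_finite:
  fixes a :: "nat \<Rightarrow> real"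
  assumes "a \<longlonglongrightarrow> 0" "finite P"
  shows "\<exists>p. p \<notin> P \<and> (\<forall>j. j \<notin> P \<longrightarrow> \<bar>a j\<bar> \<le> \<bar>a p\<bar>)"
proof (cases "\<exists>q. q \<notin> P \<and> a q \<noteq> 0")
  case True
  then obtain q where q: "q \<notin> P" "a q \<noteq> 0" by blast
  define Q where "Q = {i. \<bar>a q\<bar> \<le> \<bar>a i\<bar>} - P"
  have Q: "finite Q" "q \<in> Q" using finite_abs_ge[OF assms(1), of "\<bar>a q\<bar>"] q by (auto simp: Q_def)
  then have "Max ((\<lambda>i. \<bar>a i\<bar>) ` Q) \<in> (\<lambda>i. \<bar>a i\<bar>) ` Q" by (intro Max_in) auto
  then obtain p where p: "p \<in> Q" "Max ((\<lambda>i. \<bar>a i\<bar>) ` Q) = \<bar>a p\<bar>" by blast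
  have max: "\<bar>a j\<bar> \<le> \<bar>a p\<bar>" if "j \<in> Q" for j using p(2) Q that by (metis Max_ge finite_imageI imageI)
  have "\<bar>a j\<bar> \<le> \<bar>a p\<bar>" if "j \<notin> P" for j
  proof (cases "j \<in> Q")
    case False
    then have "\<bar>a j\<bar> < \<bar>a q\<bar>" using that by (simp add: Q_def)
    then show ?thesis using max[OF Q(2)] by simp
  qed (rule max)
  then show ?thesis using p(1) by (auto simp: Q_def)
next
  case False
  obtain p where "p \<notin> P" using ex_new_if_finite[OF infinite_UNIV_nat assms(2)] by blast
  then show ?thesis using False by (intro exI[of _ p]) auto
qed

lemma decreasing_rearrangement_eq:
  fixes a :: "nat \<Rightarrow> real"
  assumes "finite P" "p \<notin> P" and off: "\<And>j. j \<notin> P \<Longrightarrow> \<bar>a j\<bar> \<le> \<bar>a p\<bar>"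
    and on: "\<And>i. i \<in> P \<Longrightarrow> \<bar>a p\<bar> \<le> \<bar>a i\<bar>"
  shows "decreasing_rearrangement a (card P) = \<bar>a p\<bar>"
  unfolding decreasing_rearrangement_def
proof (rule cInf_eq_minimum)
  have sub: "{i. \<bar>a p\<bar> < \<bar>a i\<bar>} \<subseteq> P" using off leD by blast
  then show "\<bar>a p\<bar> \<in> {t. 0 \<le> t \<and> finite {i. t < \<bar>a i\<bar>} \<and> card {i. t < \<bar>a i\<bar>} \<le> card P}"
    using assms(1) by (auto intro: finite_subset card_mono)
  fix t assume t: "t \<in> {t. 0 \<le> t \<and> finite {i. t < \<bar>a i\<bar>} \<and> card {i. t < \<bar>a i\<bar>} \<le> card P}"
  show "\<bar>a p\<bar> \<le> t"
  proof (rule ccontr)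
    assume "\<not> \<bar>a p\<bar> \<le> t"
    then have "t < \<bar>a p\<bar>" by simp
    then have "insert p P \<subseteq> {i. t < \<bar>a i\<bar>}" using on less_le_trans by blast
    then have "card (insert p P) \<le> card {i. t < \<bar>a i\<bar>}" using t by (intro card_mono) auto
    then show False using t assms(1,2) by simp
  qed
qed

text \<open>
  Collecting the largest remaining absolute value at each step yields a set of \<open>n\<close> indices that
  carries the first \<open>n\<close> terms of the decreasing rearrangement and has the largest sum among
  all sets of that size.
\<close>

lemma sum_rearrangement_attained:
  fixes a :: "nat \<Rightarrow> real"
  assumes "a \<longlonglongrightarrow> 0"
  shows "\<exists>P. finite P \<and> card P = n \<and> (\<forall>i\<in>P. \<forall>j. j \<notin> P \<longrightarrow> \<bar>a j\<bar> \<le> \<bar>a i\<bar>) \<and>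
    (\<Sum>i<n. decreasing_rearrangement a i) = (\<Sum>i\<in>P. \<bar>a i\<bar>) \<and>
    (\<forall>A. finite A \<longrightarrow> card A = n \<longrightarrow> (\<Sum>i\<in>A. \<bar>a i\<bar>) \<le> (\<Sum>i\<in>P. \<bar>a i\<bar>))"
proof (induction n)
  case 0
  show ?case by (intro exI[of _ "{}"]) auto
next
  case (Suc n)
  then obtain P where P: "finite P" "card P = n" "\<And>i j. i \<in> P \<Longrightarrow> j \<notin> P \<Longrightarrow> \<bar>a j\<bar> \<le> \<bar>a i\<bar>"
    and eq: "(\<Sum>i<n. decreasing_rearrangement a i) = (\<Sum>i\<in>P. \<bar>a i\<bar>)"
    and le: "\<And>A. finite A \<Longrightarrow> card A = n \<Longrightarrow> (\<Sum>i\<in>A. \<bar>a i\<bar>) \<le> (\<Sum>i\<in>P. \<bar>a i\<bar>)" by blast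
  obtain p where p: "p \<notin> P" "\<And>j. j \<notin> P \<Longrightarrow> \<bar>a j\<bar> \<le> \<bar>a p\<bar>"
    using abs_max_off_finite[OF assms P(1)] by blast
  have "decreasing_rearrangement a (card P) = \<bar>a p\<bar>"
    by (intro decreasing_rearrangement_eq P(1) p P(3)[OF _ p(1)])
  then have "(\<Sum>i<Suc n. decreasing_rearrangement a i) = (\<Sum>i\<in>insert p P. \<bar>a i\<bar>)"
    using P(1,2) p(1) eq by simp
  moreover have "(\<Sum>i\<in>A. \<bar>a i\<bar>) \<le> (\<Sum>i\<in>insert p P. \<bar>a i\<bar>)" if A: "finite A" "card A = Suc n" for A
  proof -
    have "\<not> A \<subseteq> P" using A P(2) card_mono[OF P(1), of A] by linarith
    then obtain q where q: "q \<in> A" "q \<notin> P" by blast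
    have "(\<Sum>i\<in>A. \<bar>a i\<bar>) = \<bar>a q\<bar> + (\<Sum>i\<in>A - {q}. \<bar>a i\<bar>)" using A q by (simp add: sum.remove)
    also have "\<dots> \<le> \<bar>a p\<bar> + (\<Sum>i\<in>P. \<bar>a i\<bar>)"
      using A q by (intro add_mono p le) auto
    finally show ?thesis using P(1) p(1) by simp
  qed
  moreover have "\<bar>a j\<bar> \<le> \<bar>a i\<bar>" if "i \<in> insert p P" "j \<notin> insert p P" for i j
    using that P(3)[of i j] p(2)[of j] by blast
  moreover have "finite (insert p P)" "card (insert p P) = Suc n" using P(1,2) p(1) by auto
  ultimately show ?case by blast
qed

lemma sum_fun_apply: "(\<Sum>i\<in>A. f i) j = (\<Sum>i\<in>A. f i j)"
  by (induction A rule: infinite_finite_induct) (auto simp: zero_fun_def)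

lemma scaleR_fun_apply [simp]: "(c *\<^sub>R f) i = c *\<^sub>R f i"
  by (simp add: scaleR_fun_def)

lemma minus_fun_apply [simp]: "(f - g) i = f i - g i" for f g :: "nat \<Rightarrow> real"
  by (simp add: fun_diff_def)

lemma linear_eval: "linear (\<lambda>y :: nat \<Rightarrow> real. y i)"
  by (rule linearI) auto

definition unit_vector :: "nat \<Rightarrow> nat \<Rightarrow> real" where
  "unit_vector j = (\<lambda>i. if i = j then 1 else 0)"

lemma unit_combination_apply:
  assumes "finite A"
  shows "(\<Sum>n\<in>A. a n *\<^sub>R unit_vector n) i = (if i \<in> A then a i else 0)"
proof -
  have "(\<Sum>n\<in>A. a n *\<^sub>R unit_vector n) i = (\<Sum>n\<in>A. if i = n then a n else 0)"
    by (auto simp: sum_fun_apply unit_vector_def intro!: sum.cong)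
  then show ?thesis using assms by (simp add: sum.delta)
qed

text \<open>
  Regularity provides the last property: the primitive weight is unbounded.
\<close>

locale lorentz_weight =
  fixes w :: "nat \<Rightarrow> real"
  assumes pos: "0 < w n" and dec: "decseq w" and lim: "w \<longlonglongrightarrow> 0"
    and unbounded: "\<exists>n. M \<le> primitive_weight w n"
begin

abbreviation "s \<equiv> primitive_weight w"
abbreviation "N \<equiv> marcinkiewicz_norm s"
abbreviation "X \<equiv> marcinkiewicz_space s"
abbreviation "V \<equiv> marcinkiewicz_separable_part s"
abbreviation "e \<equiv> unit_vector"

lemma s_0 [simp]: "s 0 = 0" by (simp add: primitive_weight_def)

lemma s_Suc: "s (Suc n) = s n + w n" by (simp add: primitive_weight_def)

lemma s_mono: "m \<le> n \<Longrightarrow> s m \<le> s n"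
  unfolding primitive_weight_def using pos by (intro sum_mono2) (auto intro: less_imp_le)

lemma s_1_pos: "0 < s (Suc 0)" using pos by (simp add: s_Suc)

lemma s_pos: "0 < n \<Longrightarrow> 0 < s n"
  using s_mono[of "Suc 0" n] s_1_pos by simp

lemma s_nonneg: "0 \<le> s n" using s_mono[of 0 n] by simp

lemma s_1_le: "0 < n \<Longrightarrow> s (Suc 0) \<le> s n" by (simp add: s_mono)

lemma s_eventually_ge: "\<exists>n0. \<forall>n\<ge>n0. M \<le> s n"
  using unbounded[of M] s_mono order_trans by meson

lemma sum_weight_le: "finite I \<Longrightarrow> (\<Sum>i\<in>I. w i) \<le> s (card I)"
proof (induction "card I" arbitrary: I)
  case (Suc n)
  then have "I \<noteq> {}" by auto
  define m where "m = Max I"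
  have m: "m \<in> I" "I \<subseteq> {..m}" using Suc.prems \<open>I \<noteq> {}\<close> by (auto simp: m_def)
  then have "card I \<le> Suc m" using card_mono[of "{..m}" I] by simp
  then have "w m \<le> w n" using Suc.hyps(2) dec by (auto simp: decseq_def)
  moreover have "(\<Sum>i\<in>I - {m}. w i) \<le> s n"
  proof -
    have "n = card (I - {m})" using Suc.hyps(2) Suc.prems m by simp
    from Suc.hyps(1)[OF this] this show ?thesis using Suc.prems by simp
  qed
  ultimately show ?case
    using m Suc.prems Suc.hyps(2)[symmetric] by (simp add: sum.remove[of I m] s_Suc)
qed simp

text \<open>
  The averages \<open>s n / n\<close> tend to \<open>0\<close> because \<open>w\<close> does; hence the norm \<open>n / s n\<close> of a sum of
  \<open>n\<close> unit vectors is unbounded.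
\<close>

lemma linear_beats_s: "\<exists>n>0. M * s n < real n"
proof -
  define M' where "M' = max M 1"
  have "0 < 1 / (2 * M')" by (simp add: M'_def)
  then obtain k where k: "\<And>i. k \<le> i \<Longrightarrow> w i < 1 / (2 * M')"
    using order_tendstoD(2)[OF lim] by (metis eventually_sequentially)
  have s: "s (k + d) \<le> s k + real d / (2 * M')" for d
  proof (induction d)
    case (Suc d)
    then show ?case using k[of "k + d"] by (simp add: s_Suc add_divide_distrib)
  qed simp
  obtain d :: nat where d: "2 * M' * s k < real d" using reals_Archimedean2 by blast
  have "0 \<le> 2 * M' * s k" using s_nonneg by (simp add: M'_def)
  then have "0 < d" using d by (cases d) auto
  have "M * s (k + d) \<le> M' * s (k + d)" using s_nonneg by (intro mult_right_mono) (auto simp: M'_def)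
  also have "\<dots> \<le> M' * (s k + real d / (2 * M'))" by (intro mult_left_mono s) (simp add: M'_def)
  also have "\<dots> = M' * s k + real d / 2" by (simp add: M'_def field_simps)
  also have "\<dots> < real (k + d)" using d by simp
  finally show ?thesis using \<open>0 < d\<close> by (intro exI[of _ "k + d"]) simp
qed

text \<open>
  The averages of a decreasing sequence decrease.
\<close>

lemma s_concave:
  assumes "k \<le> n"
  shows "real k * s n \<le> real n * s k"
proof -
  have wk: "real k * w k \<le> s k"
  proof -
    have "(\<Sum>i<k. w k) \<le> (\<Sum>i<k. w i)" using dec by (intro sum_mono) (auto simp: decseq_def)
    then show ?thesis by (simp add: primitive_weight_def)
  qed
  have s: "s (k + d) \<le> s k + real d * w k" for d
  proof (induction d)
    case (Suc d)
    have "w (k + d) \<le> w k" using dec by (simp add: decseq_def)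
    then show ?case using Suc by (simp add: s_Suc algebra_simps)
  qed simp
  \<comment> \<open>The terms from index \<open>k\<close> on are at most \<open>w k\<close>, which is at most the average of the earlier ones.\<close>
  define d where "d = n - k"
  have n: "n = k + d" using assms by (simp add: d_def)
  have "real k * s n \<le> real k * (s k + real d * w k)" unfolding n by (intro mult_left_mono s) simp
  also have "\<dots> = real k * s k + real d * (real k * w k)" by (simp add: algebra_simps)
  also have "\<dots> \<le> real k * s k + real d * s k" by (intro add_left_mono mult_left_mono wk) simp
  finally show ?thesis by (simp add: n algebra_simps)
qed

lemma mean_le_iff:
  assumes "a \<longlonglongrightarrow> 0"
  shows "(\<forall>n\<ge>1. marcinkiewicz_mean s a n \<le> c) \<longleftrightarrow> (\<forall>A. finite A \<longrightarrow> (\<Sum>i\<in>A. \<bar>a i\<bar>) \<le> c * s (card A))"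
    (is "?L = ?R")
proof
  assume L: ?L
  show ?R
  proof (intro allI impI)
    fix A :: "nat set" assume A: "finite A"
    obtain P where P: "(\<Sum>i<card A. decreasing_rearrangement a i) = (\<Sum>i\<in>P. \<bar>a i\<bar>)"
      "(\<Sum>i\<in>A. \<bar>a i\<bar>) \<le> (\<Sum>i\<in>P. \<bar>a i\<bar>)" using sum_rearrangement_attained[OF assms, of "card A"] A by blast
    show "(\<Sum>i\<in>A. \<bar>a i\<bar>) \<le> c * s (card A)"
    proof (cases "A = {}")
      case False
      then have "0 < card A" using A by (simp add: card_gt_0_iff)
      then have "(\<Sum>i<card A. decreasing_rearrangement a i) / s (card A) \<le> c"
        using L by (simp add: marcinkiewicz_mean_def Suc_le_eq)
      then show ?thesis using P s_pos[OF \<open>0 < card A\<close>] by (simp add: pos_divide_le_eq)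
    qed simp
  qed
next
  assume R: ?R
  show ?L
  proof (intro allI impI)
    fix n :: nat assume "1 \<le> n"
    obtain P where P: "finite P" "card P = n"
      "(\<Sum>i<n. decreasing_rearrangement a i) = (\<Sum>i\<in>P. \<bar>a i\<bar>)"
      using sum_rearrangement_attained[OF assms, of n] by blast
    then have "(\<Sum>i<n. decreasing_rearrangement a i) \<le> c * s n" using R by metis
    then show "marcinkiewicz_mean s a n \<le> c"
      using s_pos[of n] \<open>1 \<le> n\<close> by (simp add: marcinkiewicz_mean_def pos_divide_le_eq)
  qed
qed

text \<open>
  This characterization and the two bounds after it are the interface through which the norm is
  used from here on; the decreasing rearrangement does not occur any more.
\<close>

lemma space_iff:
  "a \<in> X \<longleftrightarrow> a \<longlonglongrightarrow> 0 \<and> (\<exists>c. \<forall>A. finite A \<longrightarrow> (\<Sum>i\<in>A. \<bar>a i\<bar>) \<le> c * s (card A))"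
  unfolding marcinkiewicz_space_def bdd_above_def
  using mean_le_iff[of a] by auto

lemma sum_le_norm:
  assumes "a \<in> X" "finite A"
  shows "(\<Sum>i\<in>A. \<bar>a i\<bar>) \<le> N a * s (card A)"
proof -
  have "marcinkiewicz_mean s a n \<le> N a" if "1 \<le> n" for n
    unfolding marcinkiewicz_norm_def
    using assms that by (intro cSUP_upper) (auto simp: marcinkiewicz_space_def)
  then show ?thesis using mean_le_iff[of a "N a"] assms by (auto simp: marcinkiewicz_space_def)
qed

lemma norm_leI:
  assumes "a \<longlonglongrightarrow> 0" "\<And>A. finite A \<Longrightarrow> (\<Sum>i\<in>A. \<bar>a i\<bar>) \<le> c * s (card A)"
  shows "a \<in> X" "N a \<le> c"
proof -
  show "a \<in> X" using assms space_iff by blast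
  have "\<forall>n\<ge>1. marcinkiewicz_mean s a n \<le> c" using mean_le_iff[OF assms(1)] assms(2) by blast
  then show "N a \<le> c" unfolding marcinkiewicz_norm_def by (intro cSUP_least) auto
qed

lemma space_tendsto: "a \<in> X \<Longrightarrow> a \<longlonglongrightarrow> 0" by (simp add: marcinkiewicz_space_def)

lemma coord_le_norm: "a \<in> X \<Longrightarrow> \<bar>a i\<bar> \<le> N a * s (Suc 0)"
  using sum_le_norm[of a "{i}"] by simp

lemma norm_nonneg: "a \<in> X \<Longrightarrow> 0 \<le> N a"
  using coord_le_norm[of a 0] s_1_pos by (metis abs_ge_zero order_trans zero_le_mult_iff not_less)

lemma norm_mono:
  assumes "u \<in> X" "\<And>i. \<bar>v i\<bar> \<le> \<bar>u i\<bar>"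
  shows "v \<in> X" "N v \<le> N u"
proof -
  have "v \<longlonglongrightarrow> 0"
    using tendsto_rabs_zero[OF space_tendsto[OF assms(1)]] assms(2)
    by (intro Lim_null_comparison[of v "\<lambda>i. \<bar>u i\<bar>"]) auto
  moreover have "(\<Sum>i\<in>A. \<bar>v i\<bar>) \<le> N u * s (card A)" if "finite A" for A
    using sum_mono[of A "\<lambda>i. \<bar>v i\<bar>" "\<lambda>i. \<bar>u i\<bar>"] assms sum_le_norm[OF assms(1) that] by force
  ultimately show "v \<in> X" "N v \<le> N u" using norm_leI by blast+
qed

lemma space_add:
  assumes "u \<in> X" "v \<in> X"
  shows "u + v \<in> X" "N (u + v) \<le> N u + N v"
proof -
  have "(\<lambda>i. u i + v i) \<longlonglongrightarrow> 0 + 0" using assms by (intro tendsto_add space_tendsto)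
  then have "u + v \<longlonglongrightarrow> 0" by (simp add: plus_fun_def)
  moreover have "(\<Sum>i\<in>A. \<bar>(u + v) i\<bar>) \<le> (N u + N v) * s (card A)" if "finite A" for A
  proof -
    have "(\<Sum>i\<in>A. \<bar>(u + v) i\<bar>) \<le> (\<Sum>i\<in>A. \<bar>u i\<bar> + \<bar>v i\<bar>)" by (intro sum_mono) auto
    then show ?thesis
      using sum_le_norm[OF assms(1) that] sum_le_norm[OF assms(2) that]
      by (simp add: sum.distrib distrib_right)
  qed
  ultimately show "u + v \<in> X" "N (u + v) \<le> N u + N v" using norm_leI by blast+
qed

lemma space_scale:
  assumes "v \<in> X"
  shows "c *\<^sub>R v \<in> X" "N (c *\<^sub>R v) = \<bar>c\<bar> * N v"
proof -
  have le: "c *\<^sub>R v \<in> X \<and> N (c *\<^sub>R v) \<le> \<bar>c\<bar> * N v" if "v \<in> X" for c v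
  proof -
    have "(\<lambda>i. c * v i) \<longlonglongrightarrow> c * 0" using that by (intro tendsto_mult_left space_tendsto)
    then have "c *\<^sub>R v \<longlonglongrightarrow> 0" by (simp add: scaleR_fun_def)
    moreover have "(\<Sum>i\<in>A. \<bar>(c *\<^sub>R v) i\<bar>) \<le> \<bar>c\<bar> * N v * s (card A)" if "finite A" for A
      using mult_left_mono[OF sum_le_norm[OF \<open>v \<in> X\<close> that], of "\<bar>c\<bar>"]
      by (simp add: abs_mult sum_distrib_left mult.assoc)
    ultimately show ?thesis using norm_leI by blast
  qed
  show "c *\<^sub>R v \<in> X" using le assms by blast
  show "N (c *\<^sub>R v) = \<bar>c\<bar> * N v"
  proof (cases "c = 0")
    case True
    then show ?thesis using le[OF assms, of c] norm_nonneg[of "c *\<^sub>R v"] by simp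
  next
    case False
    have "N (inverse c *\<^sub>R (c *\<^sub>R v)) \<le> \<bar>inverse c\<bar> * N (c *\<^sub>R v)" using le assms by blast
    then have "N v \<le> N (c *\<^sub>R v) / \<bar>c\<bar>" using False by (simp add: divide_inverse mult.commute)
    then have "\<bar>c\<bar> * N v \<le> N (c *\<^sub>R v)" using False by (simp add: pos_le_divide_eq mult.commute)
    then show ?thesis using le[OF assms, of c] by simp
  qed
qed

lemma c00_in_space: "b \<in> c00 \<Longrightarrow> b \<in> X"
proof -
  assume "b \<in> c00"
  then have fin: "finite {i. b i \<noteq> 0}" by (simp add: c00_def)
  define L where "L = (\<Sum>i | b i \<noteq> 0. \<bar>b i\<bar>)"
  have "0 \<le> L" by (simp add: L_def sum_nonneg)
  have "b \<longlonglongrightarrow> 0"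
    using fin by (intro tendsto_eventually) (simp add: cofinite_eq_sequentially[symmetric] eventually_cofinite)
  moreover have "(\<Sum>i\<in>A. \<bar>b i\<bar>) \<le> (L / s (Suc 0)) * s (card A)" if A: "finite A" for A
  proof (cases "A = {}")
    case False
    have "(\<Sum>i\<in>A. \<bar>b i\<bar>) = (\<Sum>i\<in>A \<inter> {i. b i \<noteq> 0}. \<bar>b i\<bar>)"
      using A by (intro sum.mono_neutral_right) auto
    also have "\<dots> \<le> L" unfolding L_def using fin by (intro sum_mono2) auto
    also have "L * s (Suc 0) \<le> L * s (card A)"
      using False A \<open>0 \<le> L\<close> by (intro mult_left_mono s_1_le) (auto simp: card_gt_0_iff)
    then have "L \<le> (L / s (Suc 0)) * s (card A)" using s_1_pos by (simp add: field_simps)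
    finally show ?thesis .
  qed simp
  ultimately show "b \<in> X" using norm_leI by blast
qed

lemma c00_add_scale: "b \<in> c00 \<Longrightarrow> c \<in> c00 \<Longrightarrow> b + t *\<^sub>R c \<in> c00"
proof -
  assume "b \<in> c00" "c \<in> c00"
  then have "finite ({i. b i \<noteq> 0} \<union> {i. c i \<noteq> 0})" by (simp add: c00_def)
  then have "finite {i. (b + t *\<^sub>R c) i \<noteq> 0}" by (rule rev_finite_subset) auto
  then show ?thesis by (simp add: c00_def)
qed

lemma sepI: "a \<in> X \<Longrightarrow> (\<And>\<epsilon>. 0 < \<epsilon> \<Longrightarrow> \<exists>b\<in>c00. N (a - b) < \<epsilon>) \<Longrightarrow> a \<in> V"
  by (simp add: marcinkiewicz_separable_part_def)

lemma sep_in_space: "a \<in> V \<Longrightarrow> a \<in> X"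
  by (simp add: marcinkiewicz_separable_part_def)

lemma sep_approx: "a \<in> V \<Longrightarrow> 0 < \<epsilon> \<Longrightarrow> \<exists>b\<in>c00. N (a - b) < \<epsilon>"
  by (simp add: marcinkiewicz_separable_part_def)

lemma space_diff: "u \<in> X \<Longrightarrow> v \<in> X \<Longrightarrow> u - v \<in> X" 
  using space_add(1)[of u "- 1 *\<^sub>R v"] space_scale(1)[of v "-1"] by simp

lemma zero_in_space: "0 \<in> X"
  by (rule c00_in_space) (simp add: c00_def)

lemma norm_zero: "N 0 = 0"
  using space_scale(2)[OF zero_in_space, of 0] by simp

lemma c00_in_sep: "b \<in> c00 \<Longrightarrow> b \<in> V"
  by (rule sepI) (auto simp: norm_zero c00_in_space intro: bexI[of _ b])

lemma sep_add_scale: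
  assumes "u \<in> V" "v \<in> V"
  shows "u + t *\<^sub>R v \<in> V"
proof (rule sepI)
  show "u + t *\<^sub>R v \<in> X" using assms by (intro space_add space_scale sep_in_space)
  fix \<epsilon> :: real assume "0 < \<epsilon>"
  define \<delta> where "\<delta> = \<epsilon> / (1 + \<bar>t\<bar>)"
  have "0 < \<delta>" using \<open>0 < \<epsilon>\<close> by (simp add: \<delta>_def add_pos_nonneg)
  then obtain b c where b: "b \<in> c00" "N (u - b) < \<delta>" and c: "c \<in> c00" "N (v - c) < \<delta>"
    using sep_approx assms by metis
  have X: "u - b \<in> X" "v - c \<in> X" using assms b c by (meson space_diff sep_in_space c00_in_space)+
  have "N (u + t *\<^sub>R v - (b + t *\<^sub>R c)) = N ((u - b) + t *\<^sub>R (v - c))" by (simp add: algebra_simps)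
  also have "\<dots> \<le> N (u - b) + \<bar>t\<bar> * N (v - c)"
    using X space_add(2)[of "u - b" "t *\<^sub>R (v - c)"] space_scale[of "v - c" t] by simp
  also have "\<dots> < \<delta> + \<bar>t\<bar> * \<delta>"
    using b c by (intro add_less_le_mono mult_left_mono) auto
  also have "\<dots> = \<delta> * (1 + \<bar>t\<bar>)" by (simp add: algebra_simps)
  also have "\<dots> = \<epsilon>" using abs_ge_zero[of t] by (simp add: \<delta>_def)
  finally show "\<exists>b\<in>c00. N (u + t *\<^sub>R v - b) < \<epsilon>" using c00_add_scale[OF b(1) c(1)] by blast
qed

sublocale seminormed_carrier V N
proof
  have z: "0 \<in> V" by (rule c00_in_sep) (simp add: c00_def)
  show "subspace V"
    using sep_add_scale[of _ _ 1] sep_add_scale[OF z] z by (auto simp: subspace_def)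
qed (auto intro: norm_nonneg space_add space_scale sep_in_space)

text \<open>
  A finitely supported approximation of \<open>v\<close> has bounded \<open>\<ell>_1\<close> norm, which is negligible against
  \<open>s\<close> of a large cardinality.
\<close>

lemma sep_tail:
  assumes "v \<in> V" "0 < \<epsilon>"
  shows "\<exists>m. \<forall>A. finite A \<longrightarrow> m \<le> card A \<longrightarrow> (\<Sum>i\<in>A. \<bar>v i\<bar>) \<le> \<epsilon> * s (card A)"
proof -
  have "0 < \<epsilon>/2" using assms by simp
  then obtain b where b: "b \<in> c00" "N (v - b) < \<epsilon>/2" using sep_approx assms by metis
  define L where "L = (\<Sum>i | b i \<noteq> 0. \<bar>b i\<bar>)"
  obtain m where m: "\<And>n. m \<le> n \<Longrightarrow> L / (\<epsilon>/2) \<le> s n" using s_eventually_ge by blast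
  have "(\<Sum>i\<in>A. \<bar>v i\<bar>) \<le> \<epsilon> * s (card A)" if A: "finite A" "m \<le> card A" for A
  proof -
    have "(\<Sum>i\<in>A. \<bar>v i\<bar>) \<le> (\<Sum>i\<in>A. \<bar>(v - b) i\<bar> + \<bar>b i\<bar>)" by (intro sum_mono) auto
    also have "\<dots> = (\<Sum>i\<in>A. \<bar>(v - b) i\<bar>) + (\<Sum>i\<in>A. \<bar>b i\<bar>)" by (simp add: sum.distrib)
    also have "(\<Sum>i\<in>A. \<bar>b i\<bar>) = (\<Sum>i\<in>A \<inter> {i. b i \<noteq> 0}. \<bar>b i\<bar>)"
      using A by (intro sum.mono_neutral_right) auto
    also have "\<dots> \<le> L" unfolding L_def using b(1) by (intro sum_mono2) (auto simp: c00_def)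
    also have "L \<le> \<epsilon>/2 * s (card A)" using m[OF A(2)] assms(2) by (simp add: field_simps)
    also have "(\<Sum>i\<in>A. \<bar>(v - b) i\<bar>) \<le> N (v - b) * s (card A)"
      using assms b A by (intro sum_le_norm space_diff sep_in_space c00_in_space)
    also have "\<dots> \<le> \<epsilon>/2 * s (card A)" using b s_nonneg by (intro mult_right_mono) auto
    finally show ?thesis by simp
  qed
  then show ?thesis by blast
qed

section \<open>The unit vectors form a greedy basis\<close>

lemma unit_in_c00: "e j \<in> c00"
  by (simp add: c00_def unit_vector_def)

lemma unit_in_V [simp, intro]: "e j \<in> V"
  by (intro c00_in_sep unit_in_c00)

lemma norm_unimodular_le:
  assumes "finite A" "\<And>n. n \<in> A \<Longrightarrow> \<bar>\<theta> n\<bar> \<le> 1"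
  shows "N (\<Sum>n\<in>A. \<theta> n *\<^sub>R e n) \<le> real (card A) / s (card A)"
proof (cases "A = {}")
  case False
  then have A: "0 < card A" using assms(1) by (simp add: card_gt_0_iff)
  show ?thesis
  proof (rule norm_leI(2))
    show "(\<Sum>n\<in>A. \<theta> n *\<^sub>R e n) \<longlonglongrightarrow> 0" by (intro space_tendsto sep_in_space) auto
    fix B :: "nat set" assume B: "finite B"
    have le: "card (B \<inter> A) \<le> card A" "card (B \<inter> A) \<le> card B"
      using assms(1) B by (auto intro: card_mono)
    have "(\<Sum>i\<in>B. \<bar>(\<Sum>n\<in>A. \<theta> n *\<^sub>R e n) i\<bar>) = (\<Sum>i\<in>B \<inter> A. \<bar>\<theta> i\<bar>)"
      using B by (simp add: unit_combination_apply[OF assms(1)] if_distrib sum.inter_restrict cong: if_cong)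
    also have "\<dots> \<le> real (card (B \<inter> A))"
      using sum_bounded_above[of "B \<inter> A" "\<lambda>i. \<bar>\<theta> i\<bar>" 1] assms(2) by simp
    also have "\<dots> \<le> real (card A) / s (card A) * s (card (B \<inter> A))"
      using s_concave[OF le(1)] s_pos[OF A] by (simp add: field_simps)
    also have "\<dots> \<le> real (card A) / s (card A) * s (card B)"
      using s_nonneg by (intro mult_left_mono s_mono le) auto
    finally show "(\<Sum>i\<in>B. \<bar>(\<Sum>n\<in>A. \<theta> n *\<^sub>R e n) i\<bar>) \<le> real (card A) / s (card A) * s (card B)" .
  qed
qed (simp add: norm_zero)

lemma norm_unit: "N (e j) = 1 / s (Suc 0)"
proof (rule antisym)
  show "N (e j) \<le> 1 / s (Suc 0)" using norm_unimodular_le[of "{j}" "\<lambda>_. 1"] by simp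
  have "1 \<le> N (e j) * s (Suc 0)"
    using coord_le_norm[OF sep_in_space[OF unit_in_V], of j j] by (simp add: unit_vector_def)
  then show "1 / s (Suc 0) \<le> N (e j)" using s_1_pos by (simp add: pos_divide_le_eq)
qed

lemma expands_unit: "v \<in> V \<Longrightarrow> expands N e v v"
  unfolding expands_def
proof (rule LIMSEQ_I)
  fix r :: real assume v: "v \<in> V" and "0 < r"
  then obtain b where b: "b \<in> c00" "N (v - b) < r" using sep_approx by blast
  obtain m0 where m0: "{i. b i \<noteq> 0} \<subseteq> {..<m0}"
    using b(1) finite_nat_iff_bounded by (auto simp: c00_def)
  have "norm (N (v - (\<Sum>n<m. v n *\<^sub>R e n)) - 0) < r" if "m0 \<le> m" for m
  proof -
    have vb: "v - b \<in> X" using v b by (intro space_diff sep_in_space c00_in_space)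
    have "\<bar>(v - (\<Sum>n<m. v n *\<^sub>R e n)) i\<bar> \<le> \<bar>(v - b) i\<bar>" for i
      using m0 that by (cases "b i = 0") (auto simp: unit_combination_apply)
    from norm_mono[OF vb, of "v - (\<Sum>n<m. v n *\<^sub>R e n)", OF this] norm_nonneg b(2)
    show ?thesis by (simp add: abs_of_nonneg)
  qed
  then show "\<exists>m0. \<forall>m\<ge>m0. norm (N (v - (\<Sum>n<m. v n *\<^sub>R e n)) - 0) < r" by blast
qed

lemma expands_unit_unique:
  assumes v: "v \<in> V" and a: "expands N e v a"
  shows "a = v"
proof
  fix i
  have "(\<lambda>m. N (v - (\<Sum>n<m. a n *\<^sub>R e n)) * s (Suc 0)) \<longlonglongrightarrow> 0 * s (Suc 0)"
    using a unfolding expands_def by (intro tendsto_intros)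
  moreover have "\<forall>\<^sub>F m in sequentially. \<bar>v i - a i\<bar> \<le> N (v - (\<Sum>n<m. a n *\<^sub>R e n)) * s (Suc 0)"
  proof (rule eventually_sequentiallyI[of "Suc i"])
    fix m assume "Suc i \<le> m"
    moreover have "v - (\<Sum>n<m. a n *\<^sub>R e n) \<in> X" using v by (intro sep_in_space) blast
    ultimately show "\<bar>v i - a i\<bar> \<le> N (v - (\<Sum>n<m. a n *\<^sub>R e n)) * s (Suc 0)"
      using coord_le_norm[of "v - (\<Sum>n<m. a n *\<^sub>R e n)" i] by (simp add: unit_combination_apply)
  qed
  ultimately have "\<bar>v i - a i\<bar> \<le> 0 * s (Suc 0)"
    by (intro tendsto_le[OF _ _ tendsto_const]) auto
  then show "a i = v i" by simp
qed

lemma unit_schauder: "schauder_basis V N e"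
  unfolding schauder_basis_def using expands_unit expands_unit_unique by blast

lemma unit_coeff: "v \<in> V \<Longrightarrow> basis_coeff N e v = v"
  unfolding basis_coeff_def using expands_unit expands_unit_unique by (intro the_equality)

text \<open>
  The indices of \<open>A\<close> outside \<open>\<Lambda>\<close> are matched injectively with indices of \<open>\<Lambda>\<close> outside \<open>A\<close>. There the
  competitor agrees with \<open>v\<close>, which is at least as large, so every sum of the greedy remainder
  is dominated by a sum of the competitor over a set that is not larger.
\<close>

lemma norm_minus_greedy_sum_le:
  assumes v: "v \<in> V" and "finite \<Lambda>" "finite A" "card A = card \<Lambda>"
    and max: "\<And>n m. \<lbrakk>n \<in> \<Lambda>; m \<notin> \<Lambda>\<rbrakk> \<Longrightarrow> \<bar>v m\<bar> \<le> \<bar>v n\<bar>"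
  shows "N (v - (\<Sum>n\<in>\<Lambda>. v n *\<^sub>R e n)) \<le> N (v - (\<Sum>n\<in>A. \<alpha> n *\<^sub>R e n))"
proof (rule norm_leI(2))
  define u where "u = v - (\<Sum>n\<in>A. \<alpha> n *\<^sub>R e n)"
  define g where "g = v - (\<Sum>n\<in>\<Lambda>. v n *\<^sub>R e n)"
  have u: "u \<in> X" unfolding u_def using v by (intro sep_in_space) blast
  have u_off: "u i = v i" if "i \<notin> A" for i using that assms(3) by (simp add: u_def unit_combination_apply)
  have g: "g i = (if i \<in> \<Lambda> then 0 else v i)" for i using assms(2) by (simp add: g_def unit_combination_apply)
  show "g \<longlonglongrightarrow> 0" unfolding g_def using v by (intro space_tendsto sep_in_space) blast
  have "card (A - \<Lambda>) = card (\<Lambda> - A)"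
    using assms(2-4) by (simp add: card_Diff_subset_Int Int_commute)
  then obtain \<pi> where \<pi>: "bij_betw \<pi> (A - \<Lambda>) (\<Lambda> - A)"
    using finite_same_card_bij assms(2,3) by (metis finite_Diff)
  fix B :: "nat set" assume B: "finite B"
  define B1 where "B1 = B - \<Lambda> - A"
  define B2 where "B2 = B \<inter> (A - \<Lambda>)"
  have fin: "finite B1" "finite B2" using B by (auto simp: B1_def B2_def)
  have inj: "inj_on \<pi> B2" using \<pi> by (auto simp: bij_betw_def B2_def intro: inj_on_subset)
  have im: "\<pi> ` B2 \<subseteq> \<Lambda> - A" using \<pi> by (auto simp: bij_betw_def B2_def)
  have disj: "B1 \<inter> \<pi> ` B2 = {}" using im by (auto simp: B1_def)
  have "card (B1 \<union> \<pi> ` B2) = card B1 + card B2"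
    using fin disj by (simp add: card_Un_disjoint card_image[OF inj])
  also have "\<dots> = card (B1 \<union> B2)" using fin by (subst card_Un_disjoint) (auto simp: B1_def B2_def)
  also have "\<dots> \<le> card B" using B by (intro card_mono) (auto simp: B1_def B2_def)
  finally have card: "card (B1 \<union> \<pi> ` B2) \<le> card B" .
  have "(\<Sum>i\<in>B. \<bar>g i\<bar>) = (\<Sum>i\<in>B1 \<union> B2. \<bar>g i\<bar>)"
    using B by (intro sum.mono_neutral_right) (auto simp: B1_def B2_def g)
  also have "\<dots> = (\<Sum>i\<in>B1. \<bar>g i\<bar>) + (\<Sum>i\<in>B2. \<bar>g i\<bar>)"
    using fin by (intro sum.union_disjoint) (auto simp: B1_def B2_def)
  also have "\<dots> \<le> (\<Sum>i\<in>B1. \<bar>u i\<bar>) + (\<Sum>i\<in>B2. \<bar>u (\<pi> i)\<bar>)"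
  proof (intro add_mono sum_mono)
    fix i assume "i \<in> B1"
    then show "\<bar>g i\<bar> \<le> \<bar>u i\<bar>" by (simp add: B1_def g u_off)
  next
    fix i assume i: "i \<in> B2"
    then have "\<pi> i \<in> \<Lambda> - A" using im by blast
    then show "\<bar>g i\<bar> \<le> \<bar>u (\<pi> i)\<bar>" using i max[of "\<pi> i" i] by (simp add: B2_def g u_off)
  qed
  also have "\<dots> = (\<Sum>i\<in>B1 \<union> \<pi> ` B2. \<bar>u i\<bar>)"
    using fin disj by (simp add: sum.union_disjoint sum.reindex[OF inj])
  also have "\<dots> \<le> N u * s (card (B1 \<union> \<pi> ` B2))" using u fin by (intro sum_le_norm) auto
  also have "\<dots> \<le> N u * s (card B)" using norm_nonneg[OF u] by (intro mult_left_mono s_mono card)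
  finally show "(\<Sum>i\<in>B. \<bar>g i\<bar>) \<le> N u * s (card B)" .
qed

lemma unit_greedy: "greedy_basis V N e"
  unfolding greedy_basis_def
proof (intro conjI exI[of _ 1] ballI allI impI)
  show "schauder_basis V N e" by (rule unit_schauder)
  show "semi_normalized N e" using s_1_pos by (simp add: semi_normalized_def norm_unit)
  fix v n \<Lambda> assume v: "v \<in> V" and \<Lambda>: "finite \<Lambda>" "card \<Lambda> = n"
    "\<forall>n\<in>\<Lambda>. \<forall>m\<in>-\<Lambda>. \<bar>basis_coeff N e v m\<bar> \<le> \<bar>basis_coeff N e v n\<bar>"
  have "N (v - (\<Sum>n\<in>\<Lambda>. v n *\<^sub>R e n)) \<le> best_approx_error N e v n"
    using v \<Lambda> by (intro best_approx_error_greatest norm_minus_greedy_sum_le) (auto simp: unit_coeff)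
  then show "N (v - (\<Sum>n\<in>\<Lambda>. basis_coeff N e v n *\<^sub>R e n)) \<le> 1 * best_approx_error N e v n"
    by (simp add: unit_coeff[OF v])
qed

end


section \<open>Greedy bases of the separable part\<close>

text \<open>
  If a positive supremum is not bounded away from \<open>0\<close>, it is small at infinitely many indices.
\<close>

lemma uniformly_small_outside_finite:
  fixes g :: "'i \<Rightarrow> 'j \<Rightarrow> real"
  assumes pos: "\<And>n. \<exists>j. 0 < g n j" and small: "\<not> (\<exists>\<delta>>0. \<forall>n. \<exists>j. \<delta> \<le> g n j)"
    and "finite F" "0 < \<tau>"
  shows "\<exists>n. n \<notin> F \<and> (\<forall>j. g n j < \<tau>)"
proof -
  obtain j where j: "\<And>n. 0 < g n (j n)" using pos by metis
  define \<delta> where "\<delta> = Min (insert \<tau> ((\<lambda>n. g n (j n)) ` F))"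
  have "0 < \<delta>" using assms(3,4) j by (simp add: \<delta>_def)
  then have "\<not> (\<forall>n. \<exists>j. \<delta> \<le> g n j)" using small by blast
  then obtain n where n: "\<And>j. g n j < \<delta>" by (auto simp: not_le)
  have "\<delta> \<le> g m (j m)" if "m \<in> F" for m using that assms(3) by (simp add: \<delta>_def)
  then have "n \<notin> F" using n[of "j n"] not_le by blast
  moreover have "\<delta> \<le> \<tau>" using assms(3) by (simp add: \<delta>_def)
  ultimately show ?thesis using n by (metis less_le_trans)
qed

context lorentz_weight
begin

lemma linear_signed_sum: "linear (\<lambda>y :: nat \<Rightarrow> real. \<Sum>j\<in>B. \<eta> j * y j)"
  by (rule linearI) (auto simp: sum.distrib distrib_left sum_distrib_left mult_ac)

lemma signed_sum_le_norm:
  assumes "y \<in> X" "finite B" "\<And>j. \<bar>\<eta> j\<bar> \<le> 1"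
  shows "(\<Sum>j\<in>B. \<eta> j * y j) \<le> s (card B) * N y"
proof -
  have "(\<Sum>j\<in>B. \<eta> j * y j) \<le> (\<Sum>j\<in>B. \<bar>y j\<bar>)"
  proof (rule sum_mono)
    fix j
    have "\<eta> j * y j \<le> \<bar>\<eta> j\<bar> * \<bar>y j\<bar>" by (metis abs_ge_self abs_mult)
    also have "\<dots> \<le> 1 * \<bar>y j\<bar>" using assms(3) by (intro mult_right_mono) auto
    finally show "\<eta> j * y j \<le> \<bar>y j\<bar>" by simp
  qed
  then show ?thesis using sum_le_norm[OF assms(1,2)] by (simp add: mult.commute)
qed

lemma norm_le_by_signed_sums:
  assumes "v \<in> X"
    and le: "\<And>B \<eta>. finite B \<Longrightarrow> (\<And>j. \<bar>\<eta> j\<bar> \<le> 1) \<Longrightarrow> (\<Sum>j\<in>B. \<eta> j * v j) \<le> s (card B) * c"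
  shows "N v \<le> c"
proof (rule norm_leI(2)[OF space_tendsto[OF assms(1)]])
  fix B :: "nat set" assume "finite B"
  have "(\<Sum>j\<in>B. \<bar>v j\<bar>) = (\<Sum>j\<in>B. sgn (v j) * v j)" by (simp add: mult.commute abs_sgn)
  also have "\<dots> \<le> s (card B) * c" by (rule le[OF \<open>finite B\<close>]) (simp add: abs_sgn_eq)
  finally show "(\<Sum>j\<in>B. \<bar>v j\<bar>) \<le> c * s (card B)" by (simp add: mult.commute)
qed

text \<open>
  A sum of absolute values over \<open>B\<close> collects at most \<open>card B\<close> terms of the decreasing sequence \<open>w\<close>,
  each at most once, hence at most \<open>s (card B)\<close>.
\<close>

lemma norm_weighted_units_le:
  assumes "finite A" "inj_on \<sigma> A" "inj_on j A" and \<epsilon>: "\<And>n. \<bar>\<epsilon> n\<bar> = 1"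
  shows "N (\<Sum>n\<in>A. \<epsilon> n *\<^sub>R (w (\<sigma> n) *\<^sub>R e (j n))) \<le> 1"
proof (rule norm_leI(2))
  let ?v = "\<Sum>n\<in>A. \<epsilon> n *\<^sub>R (w (\<sigma> n) *\<^sub>R e (j n))"
  show "?v \<longlonglongrightarrow> 0" by (intro space_tendsto sep_in_space) auto
  fix B :: "nat set" assume B: "finite B"
  define A' where "A' = {n \<in> A. j n \<in> B}"
  have A': "finite A'" "inj_on \<sigma> A'" "inj_on j A'"
    using assms by (auto simp: A'_def intro: inj_on_subset)
  have "(\<Sum>i\<in>B. \<bar>?v i\<bar>) \<le> (\<Sum>i\<in>B. \<Sum>n\<in>A. if i = j n then w (\<sigma> n) else 0)"
  proof (rule sum_mono)
    fix i
    have "\<bar>?v i\<bar> \<le> (\<Sum>n\<in>A. \<bar>(\<epsilon> n *\<^sub>R (w (\<sigma> n) *\<^sub>R e (j n))) i\<bar>)"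
      unfolding sum_fun_apply by (rule sum_abs)
    also have "\<dots> = (\<Sum>n\<in>A. if i = j n then w (\<sigma> n) else 0)"
      by (intro sum.cong) (auto simp: abs_mult \<epsilon> unit_vector_def less_imp_le[OF pos])
    finally show "\<bar>?v i\<bar> \<le> (\<Sum>n\<in>A. if i = j n then w (\<sigma> n) else 0)" .
  qed
  also have "\<dots> = (\<Sum>n\<in>A. if j n \<in> B then w (\<sigma> n) else 0)"
    using B by (subst sum.swap) simp
  also have "\<dots> = (\<Sum>n\<in>A'. w (\<sigma> n))"
    unfolding A'_def using assms(1) by (simp add: sum.inter_filter)
  also have "\<dots> = (\<Sum>i\<in>\<sigma> ` A'. w i)" by (simp add: sum.reindex[OF A'(2)])
  also have "\<dots> \<le> s (card (\<sigma> ` A'))" using A' by (intro sum_weight_le) auto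
  also have "\<dots> \<le> s (card B)"
  proof (rule s_mono)
    have "card (\<sigma> ` A') = card (j ` A')" using A' by (simp add: card_image)
    also have "\<dots> \<le> card B" using B by (intro card_mono) (auto simp: A'_def)
    finally show "card (\<sigma> ` A') \<le> card B" .
  qed
  finally show "(\<Sum>i\<in>B. \<bar>?v i\<bar>) \<le> 1 * s (card B)" by simp
qed

end

locale greedy_basis_of_marcinkiewicz =
  lorentz_weight w +
  greedy_with_constant "marcinkiewicz_separable_part (primitive_weight w)"
    "marcinkiewicz_norm (primitive_weight w)" x C
  for w x C
begin

lemma x_in_space [simp]: "x n \<in> X"
  by (rule sep_in_space) simp

text \<open>
  Otherwise \<open>k\<close> unit vectors with suitable signs would add up to a vector whose \<open>n\<close>-th coefficient
  is at least \<open>k * \<delta>\<close>, although its norm is at most \<open>k / s k\<close>.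
\<close>

lemma finite_large_unit_coeffs:
  assumes "0 < \<delta>"
  shows "finite {j. \<delta> \<le> \<bar>coeff (e j) n\<bar>}"
proof (rule ccontr)
  assume inf: "infinite {j. \<delta> \<le> \<bar>coeff (e j) n\<bar>}"
  obtain L where L: "0 < L" "\<And>v n. v \<in> V \<Longrightarrow> \<bar>coeff v n\<bar> \<le> L * N v"
    using coeff_bounded by blast
  obtain k where k: "L / \<delta> + 1 \<le> s k" using unbounded by blast
  have "0 < L / \<delta>" using L(1) assms by simp
  then have sk: "0 < s k" using k by linarith
  then have "0 < k" by (cases k) auto
  obtain B where B: "finite B" "card B = k" "B \<subseteq> {j. \<delta> \<le> \<bar>coeff (e j) n\<bar>}"
    using infinite_arbitrarily_large[OF inf] by blast
  define v where "v = (\<Sum>j\<in>B. sgn (coeff (e j) n) *\<^sub>R e j)"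
  have "v \<in> V" by (auto simp: v_def)
  have "real k * \<delta> \<le> (\<Sum>j\<in>B. \<bar>coeff (e j) n\<bar>)"
    using B sum_bounded_below[of B \<delta> "\<lambda>j. \<bar>coeff (e j) n\<bar>"] by auto
  also have "\<dots> = coeff v n"
    unfolding v_def using B(1) by (subst coeff_sum) (auto simp: abs_sgn mult.commute)
  also have "\<dots> \<le> L * N v" using L(2)[OF \<open>v \<in> V\<close>, of n] by simp
  also have "\<dots> \<le> L * (real k / s k)"
  proof (rule mult_left_mono)
    show "N v \<le> real k / s k"
      unfolding v_def B(2)[symmetric] by (rule norm_unimodular_le[OF B(1)]) (simp add: abs_sgn_eq)
  qed (use L(1) in simp)
  finally have "s k \<le> L / \<delta>" using \<open>0 < k\<close> sk assms by (simp add: field_simps)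
  then show False using k by simp
qed

text \<open>
  If the sums were bounded, a vector with uniformly small coefficients would have a small norm, as
  in \<open>c_0\<close>. The expansions of the unit vectors are almost disjoint along a suitable selection,
  so the coefficients of a sum of \<open>k\<close> selected unit vectors are bounded independently of \<open>k\<close>,
  while its norm is unbounded.
\<close>

lemma basis_sums_unbounded: "\<exists>A. finite A \<and> D < N (\<Sum>n\<in>A. x n)"
proof (rule ccontr)
  assume "\<not> ?thesis"
  then have D: "N (\<Sum>n\<in>A. x n) \<le> D" if "finite A" for A using that not_le by blast
  have "0 \<le> D" using D[of "{}"] by simp
  obtain L where L: "0 < L" "\<And>v n. v \<in> V \<Longrightarrow> \<bar>coeff v n\<bar> \<le> L * N v"
    using coeff_bounded by blast
  define c where "c = L * (1 / s (Suc 0)) + 1"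
  have "0 < c" using L(1) s_1_pos by (simp add: c_def add_pos_pos)
  define R where "R = K * (c * D) + 1"
  obtain k where k: "R * s k < real k" using linear_beats_s by blast
  have "\<exists>F. finite F \<and> card F = k \<and> inj_on id F \<and>
      (\<forall>n. (\<Sum>j\<in>F. \<bar>coeff (e j) n\<bar>) \<le> L * (1 / s (Suc 0)) + 1)"
  proof (rule select_small_overlap[where lev = "\<lambda>n. n" and h = "\<lambda>j n. \<bar>coeff (e j) n\<bar>"])
    show "\<bar>coeff (e j) n\<bar> \<le> L * (1 / s (Suc 0))" for j n
      using L(2)[OF unit_in_V, of j n] by (simp add: norm_unit)
    show "0 \<le> L * (1 / s (Suc 0))" using L(1) s_1_pos by simp
  next
    fix j and \<delta> :: real assume "0 < \<delta>"
    then obtain m where m: "\<And>n. m \<le> n \<Longrightarrow> norm (coeff (e j) n - 0) < \<delta>"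
      using LIMSEQ_D[OF coeff_tendsto_0[OF unit_in_V]] by blast
    have "\<bar>coeff (e j) n\<bar> \<le> \<delta>" if "m \<le> n" for n using m[OF that] by simp
    then show "\<exists>m. \<forall>n\<ge>m. \<bar>coeff (e j) n\<bar> \<le> \<delta>" by blast
  next
    fix F :: "nat set" and m and \<delta> :: real assume "finite F" "0 < \<delta>"
    then have "finite (F \<union> (\<Union>n<m. {j. \<delta> \<le> \<bar>coeff (e j) n\<bar>}))"
      using finite_large_unit_coeffs by auto
    then obtain j where "j \<notin> F \<union> (\<Union>n<m. {j. \<delta> \<le> \<bar>coeff (e j) n\<bar>})"
      using ex_new_if_finite[OF infinite_UNIV_nat] by blast
    then show "\<exists>j. id j \<notin> id ` F \<and> (\<forall>n<m. \<bar>coeff (e j) n\<bar> \<le> \<delta>)"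
      by (intro exI[of _ j]) (auto simp: not_le intro: less_imp_le)
  qed simp
  then obtain F where F: "finite F" "card F = k"
    and le: "\<And>n. (\<Sum>j\<in>F. \<bar>coeff (e j) n\<bar>) \<le> c" by (auto simp: c_def)
  define v where "v = (\<Sum>j\<in>F. 1 *\<^sub>R e j)"
  have v: "v \<in> V" by (auto simp: v_def)
  have cv: "\<bar>coeff v n\<bar> \<le> c" for n
  proof -
    have "coeff v n = (\<Sum>j\<in>F. 1 * coeff (e j) n)"
      unfolding v_def using F(1) by (rule coeff_sum) simp
    then show ?thesis using order_trans[OF sum_abs le[of n]] by simp
  qed
  define S where "S m = (\<Sum>n<m. coeff v n *\<^sub>R x n)" for m
  have S: "S m \<in> V" for m by (auto simp: S_def)
  have NS: "N (S m) \<le> K * (c * D)" for m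
  proof -
    have "N (S m) \<le> K * N (\<Sum>n<m. c *\<^sub>R x n)"
      unfolding S_def using cv \<open>0 < c\<close> by (intro norm_combination_mono) auto
    also have "(\<Sum>n<m. c *\<^sub>R x n) = c *\<^sub>R (\<Sum>n<m. x n)" by (simp add: scaleR_sum_right)
    also have "N \<dots> = c * N (\<Sum>n<m. x n)" using \<open>0 < c\<close> by (subst scale) auto
    also have "K * \<dots> \<le> K * (c * D)" using D \<open>0 < c\<close> K_pos by (intro mult_left_mono) auto
    finally show ?thesis .
  qed
  have "\<exists>m. \<forall>l\<ge>m. norm (N (v - S l) - 0) < 1"
    using expands_coeff[OF v] unfolding expands_def S_def by (intro LIMSEQ_D) auto
  then obtain m where "norm (N (v - S m) - 0) < 1" by blast
  then have "N (v - S m) < 1" by (simp add: abs_less_iff)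
  then have "N v \<le> R"
    using triangle[OF carrier_closed(3)[OF v S] S, of m m] NS[of m] by (simp add: R_def)
  have "real k = (\<Sum>i\<in>F. \<bar>v i\<bar>)"
    using F by (simp add: v_def unit_combination_apply[OF F(1), of "\<lambda>_. 1", simplified])
  also have "\<dots> \<le> N v * s (card F)" using v F(1) by (intro sum_le_norm sep_in_space)
  also have "\<dots> \<le> R * s k" using \<open>N v \<le> R\<close> s_nonneg F by (simp add: mult_right_mono)
  finally show False using k by simp
qed

text \<open>
  Vectors \<open>v_k\<close> with sup norm tending to \<open>0\<close> overlap little in the Marcinkiewicz norm: a fixed
  vector contributes little over large sets, a flat one over small sets. Hence some of
  them have bounded signed sums. Used as test vectors they bound the sum of the
  corresponding \<open>x_n\<close>, for any number of terms; by democracy all sums of basis vectors are then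
  bounded, contrary to \<open>basis_sums_unbounded\<close>.
\<close>

lemma no_flat_test_vectors:
  assumes flat: "\<And>\<tau> F. 0 < \<tau> \<Longrightarrow> finite F \<Longrightarrow>
    \<exists>n v. n \<notin> F \<and> v \<in> V \<and> (\<forall>j. \<bar>v j\<bar> \<le> \<bar>x n j\<bar>) \<and> (\<forall>j. \<bar>v j\<bar> \<le> \<tau>) \<and> 1/2 \<le> coeff v n"
  shows False
proof -
  obtain U where U: "0 < U" "\<And>n. N (x n) \<le> U" using norm_x_upper by blast
  \<comment> \<open>Test vectors with signed sums at most \<open>U + 1\<close> bound the sums of the \<open>x n\<close> by
    \<open>2 * (K * (U + 1))\<close>; democracy costs the factor \<open>C * C * K\<close>.\<close>
  define c where "c = C * C * K * (2 * (K * (U + 1)))"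
  have "\<forall>k. \<exists>n v. n \<notin> {..<k} \<and> v \<in> V \<and> (\<forall>j. \<bar>v j\<bar> \<le> \<bar>x n j\<bar>) \<and>
      (\<forall>j. \<bar>v j\<bar> \<le> 1 / real (Suc k)) \<and> 1/2 \<le> coeff v n"
    by (intro allI flat) auto
  then obtain n v where n: "\<And>k. n k \<notin> {..<k}" and v: "\<And>k. v k \<in> V"
    and dom: "\<And>k j. \<bar>v k j\<bar> \<le> \<bar>x (n k) j\<bar>" and small: "\<And>k j. \<bar>v k j\<bar> \<le> 1 / real (Suc k)"
    and test: "\<And>k. 1/2 \<le> coeff (v k) (n k)" by metis
  define h where "h k B = (\<Sum>j\<in>B. \<bar>v k j\<bar>) / s (card B)" for k B
  have h: "(\<Sum>j\<in>B. \<bar>v k j\<bar>) = h k B * s (card B)" if "finite B" for k B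
    using that s_pos[of "card B"] by (cases "B = {}") (auto simp: h_def card_gt_0_iff)
  have h_le: "h k B \<le> t" if "(\<Sum>j\<in>B. \<bar>v k j\<bar>) \<le> t * s (card B)" "0 \<le> t" for k B t
    using that s_pos[of "card B"] by (cases "card B = 0") (auto simp: h_def pos_divide_le_eq)
  have select: "\<exists>F. finite F \<and> card F = k \<and> inj_on n F \<and> (\<forall>B. (\<Sum>k\<in>F. h k B) \<le> U + 1)" for k
  proof (rule select_small_overlap[where lev = card])
    fix k B
    have "(\<Sum>j\<in>B. \<bar>v k j\<bar>) \<le> U * s (card B)"
    proof (cases "finite B")
      case True
      have "(\<Sum>j\<in>B. \<bar>v k j\<bar>) \<le> (\<Sum>j\<in>B. \<bar>x (n k) j\<bar>)" by (intro sum_mono dom)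
      also have "\<dots> \<le> N (x (n k)) * s (card B)" using True by (intro sum_le_norm) auto
      also have "\<dots> \<le> U * s (card B)" using U s_nonneg by (intro mult_right_mono) auto
      finally show ?thesis .
    qed simp
    then show "h k B \<le> U" using U(1) by (intro h_le) auto
  next
    fix k and \<epsilon> :: real assume "0 < \<epsilon>"
    then obtain m where m: "\<And>A. finite A \<Longrightarrow> m \<le> card A \<Longrightarrow> (\<Sum>i\<in>A. \<bar>v k i\<bar>) \<le> \<epsilon> * s (card A)"
      using sep_tail[OF v] by blast
    have "h k B \<le> \<epsilon>" if "m \<le> card B" for B
      using m[OF _ that] \<open>0 < \<epsilon>\<close> by (intro h_le) (cases "finite B", auto)
    then show "\<exists>m. \<forall>B. m \<le> card B \<longrightarrow> h k B \<le> \<epsilon>" by blast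
  next
    fix F :: "nat set" and m and \<epsilon> :: real assume F: "finite F" and "0 < \<epsilon>"
    obtain q :: nat where q: "real m / (\<epsilon> * s (Suc 0)) < real q" using reals_Archimedean2 by blast
    obtain p where p: "n ` F \<subseteq> {..<p}" using F finite_nat_iff_bounded by blast
    define k where "k = max p q"
    have "n k \<notin> n ` F" using p n[of k] by (auto simp: k_def)
    moreover have "h k B \<le> \<epsilon>" if "card B < m" for B
    proof (rule h_le)
      show "(\<Sum>j\<in>B. \<bar>v k j\<bar>) \<le> \<epsilon> * s (card B)"
      proof (cases "finite B \<and> B \<noteq> {}")
        case True
        have "(\<Sum>j\<in>B. \<bar>v k j\<bar>) \<le> real (card B) * (1 / real (Suc k))"
          using small by (intro sum_bounded_above)
        also have "\<dots> \<le> real m * (1 / real (Suc k))"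
          using that by (intro mult_right_mono) auto
        also have "\<dots> \<le> \<epsilon> * s (Suc 0)"
        proof -
          have "0 < \<epsilon> * s (Suc 0)" using \<open>0 < \<epsilon>\<close> s_1_pos by simp
          then have "real m < real q * (\<epsilon> * s (Suc 0))" using q by (simp add: pos_divide_less_eq)
          also have "\<dots> \<le> real (Suc k) * (\<epsilon> * s (Suc 0))"
            using \<open>0 < \<epsilon> * s (Suc 0)\<close> by (intro mult_right_mono) (auto simp: k_def)
          finally show ?thesis by (simp add: pos_divide_le_eq mult.commute)
        qed
        also have "\<dots> \<le> \<epsilon> * s (card B)"
          using True \<open>0 < \<epsilon>\<close> by (intro mult_left_mono s_1_le) (auto simp: card_gt_0_iff)
        finally show ?thesis .
      next
        case False
        then show ?thesis by auto
      qed
    qed (use \<open>0 < \<epsilon>\<close> in simp)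
    ultimately show "\<exists>k. n k \<notin> n ` F \<and> (\<forall>B. card B < m \<longrightarrow> h k B \<le> \<epsilon>)" by blast
  qed (use U in auto)
  obtain A0 where A0: "finite A0" "c < N (\<Sum>n\<in>A0. x n)" using basis_sums_unbounded by blast
  obtain F where F: "finite F" "card F = card A0" "inj_on n F"
    and sum_h: "\<And>B. (\<Sum>k\<in>F. h k B) \<le> U + 1" using select by blast
  define A where "A = n ` F"
  have A: "finite A" "card A = card A0" using F by (auto simp: A_def card_image)
  define k where "k = inv_into F n"
  have k: "k (n i) = i" if "i \<in> F" for i using F(3) that by (simp add: k_def)
  have signs: "N (\<Sum>i\<in>A. \<epsilon> i *\<^sub>R v (k i)) \<le> U + 1" if \<epsilon>: "\<forall>i. \<bar>\<epsilon> i\<bar> = 1" for \<epsilon>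
  proof (rule norm_leI(2))
    show "(\<Sum>i\<in>A. \<epsilon> i *\<^sub>R v (k i)) \<longlonglongrightarrow> 0" using v by (intro space_tendsto sep_in_space) auto
    fix B :: "nat set" assume B: "finite B"
    have "(\<Sum>j\<in>B. \<bar>(\<Sum>i\<in>A. \<epsilon> i *\<^sub>R v (k i)) j\<bar>) \<le> (\<Sum>j\<in>B. \<Sum>i\<in>A. \<bar>v (k i) j\<bar>)"
    proof (rule sum_mono)
      fix j
      show "\<bar>(\<Sum>i\<in>A. \<epsilon> i *\<^sub>R v (k i)) j\<bar> \<le> (\<Sum>i\<in>A. \<bar>v (k i) j\<bar>)"
        using sum_abs[of "\<lambda>i. \<epsilon> i * v (k i) j" A] \<epsilon> by (simp add: sum_fun_apply abs_mult)
    qed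
    also have "\<dots> = (\<Sum>i\<in>A. h (k i) B) * s (card B)"
      by (subst sum.swap) (simp add: h[OF B] sum_distrib_right)
    also have "(\<Sum>i\<in>A. h (k i) B) = (\<Sum>i\<in>F. h i B)"
      unfolding A_def by (simp add: sum.reindex[OF F(3)] k)
    also have "\<dots> * s (card B) \<le> (U + 1) * s (card B)"
      using sum_h s_nonneg by (intro mult_right_mono)
    finally show "(\<Sum>j\<in>B. \<bar>(\<Sum>i\<in>A. \<epsilon> i *\<^sub>R v (k i)) j\<bar>) \<le> (U + 1) * s (card B)" .
  qed
  have "N (\<Sum>n\<in>A. x n) \<le> 2 * (K * (U + 1))"
  proof (rule norm_le_by_signed_sums)
    show "(\<Sum>n\<in>A. x n) \<in> X" by (intro sep_in_space) auto
    fix B :: "nat set" and \<eta> :: "nat \<Rightarrow> real" assume B: "finite B" and \<eta>: "\<And>j. \<bar>\<eta> j\<bar> \<le> 1"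
    define f where "f y = (\<Sum>j\<in>B. \<eta> j * y j)" for y :: "nat \<Rightarrow> real"
    have f: "linear f" unfolding f_def by (rule linear_signed_sum)
    have "f (\<Sum>n\<in>A. x n) = (\<Sum>n\<in>A. f (x n))" using f by (simp add: linear_sum)
    also have "\<dots> \<le> (\<Sum>n\<in>A. 2 * \<bar>f (x n) * coeff (v (k n)) n\<bar>)"
    proof (rule sum_mono)
      fix i assume "i \<in> A"
      then have "1/2 \<le> coeff (v (k i)) i" using test k by (auto simp: A_def)
      then have "\<bar>f (x i)\<bar> * (1/2) \<le> \<bar>f (x i)\<bar> * \<bar>coeff (v (k i)) i\<bar>" by (intro mult_left_mono) auto
      then show "f (x i) \<le> 2 * \<bar>f (x i) * coeff (v (k i)) i\<bar>" by (simp add: abs_mult)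
    qed
    also have "\<dots> = 2 * (\<Sum>n\<in>A. \<bar>f (x n) * coeff (v (k n)) n\<bar>)" by (simp add: sum_distrib_left)
    also have "\<dots> \<le> 2 * (s (card B) * (K * (U + 1)))"
      using A v f s_nonneg signs unfolding f_def
      by (intro mult_left_mono functional_test_vectors signed_sum_le_norm sep_in_space B \<eta>) auto
    finally show "(\<Sum>j\<in>B. \<eta> j * (\<Sum>n\<in>A. x n) j) \<le> s (card B) * (2 * (K * (U + 1)))"
      by (simp add: f_def algebra_simps)
  qed
  then have "N (\<Sum>n\<in>A0. x n) \<le> c"
    using democratic[OF A0(1) A(1)] A(2) C_ge_1 K_pos unfolding c_def
    by (intro order_trans[OF democratic[OF A0(1) A(1)]] mult_left_mono) auto
  then show False using A0(2) by simp
qed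

text \<open>
  Otherwise the \<open>x_n\<close> themselves are flat test vectors.
\<close>

lemma coord_uniformly_large: "\<exists>\<delta>>0. \<forall>n. \<exists>j. \<delta> \<le> \<bar>x n j\<bar>"
proof (rule ccontr)
  assume not: "\<not> ?thesis"
  obtain l where l: "0 < l" "\<And>n. l \<le> N (x n)" using norm_x_lower by blast
  have nonzero: "\<exists>j. 0 < \<bar>x n j\<bar>" for n
  proof (rule ccontr)
    assume "\<not> ?thesis"
    then have "x n = 0" by (auto simp: fun_eq_iff)
    then show False using l(2)[of n] l(1) by simp
  qed
  show False
  proof (rule no_flat_test_vectors)
    fix \<tau> :: real and F :: "nat set" assume "0 < \<tau>" "finite F"
    then obtain n where n: "n \<notin> F" "\<And>j. \<bar>x n j\<bar> < \<tau>"
      using uniformly_small_outside_finite[of "\<lambda>n j. \<bar>x n j\<bar>", OF nonzero not] by blast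
    have "coeff (\<Sum>i\<in>{n}. 1 *\<^sub>R x i) n = 1" by (subst coeff_finite_combination) auto
    then show "\<exists>n v. n \<notin> F \<and> v \<in> V \<and> (\<forall>j. \<bar>v j\<bar> \<le> \<bar>x n j\<bar>) \<and> (\<forall>j. \<bar>v j\<bar> \<le> \<tau>) \<and> 1/2 \<le> coeff v n"
      using n by (intro exI[of _ n] exI[of _ "x n"]) (auto intro: less_imp_le)
  qed
qed

lemma coeff_self: "coeff (x n) n = 1"
  using coeff_finite_combination[of "{n}" "\<lambda>_. 1" n] by simp

lemma coeff_minus_unit_combination:
  assumes "finite G"
  shows "coeff (x n - (\<Sum>j\<in>G. a j *\<^sub>R e j)) n = 1 - (\<Sum>j\<in>G. a j * coeff (e j) n)"
proof -
  have "coeff (x n + (-1) *\<^sub>R (\<Sum>j\<in>G. a j *\<^sub>R e j)) n = coeff (x n) n + (-1) * coeff (\<Sum>j\<in>G. a j *\<^sub>R e j) n"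
    by (rule coeff_add_scaleR) auto
  then show ?thesis using assms by (simp add: coeff_self coeff_sum)
qed

text \<open>
  A functional that vanishes on the unit vectors vanishes on their closed span, which contains
  \<open>x n\<close>.
\<close>

lemma dual_coord_nonzero: "\<exists>j. 0 < \<bar>coeff (e j) n\<bar>"
proof (rule ccontr)
  assume "\<not> ?thesis"
  then have zero: "coeff (e j) n = 0" for j by auto
  obtain L where L: "0 < L" "\<And>v n. v \<in> V \<Longrightarrow> \<bar>coeff v n\<bar> \<le> L * N v"
    using coeff_bounded by blast
  have "\<exists>m. \<forall>l\<ge>m. norm (N (x n - (\<Sum>j<l. x n j *\<^sub>R e j)) - 0) < 1 / L"
    using expands_unit[OF x_in, of n] L(1) unfolding expands_def by (intro LIMSEQ_D) auto
  then obtain m where "norm (N (x n - (\<Sum>j<m. x n j *\<^sub>R e j)) - 0) < 1 / L" by blast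
  then have "N (x n - (\<Sum>j<m. x n j *\<^sub>R e j)) < 1 / L" by (simp add: abs_less_iff)
  then have "L * N (x n - (\<Sum>j<m. x n j *\<^sub>R e j)) < 1"
    using L(1) by (simp add: pos_less_divide_eq mult.commute)
  moreover have "\<bar>coeff (x n - (\<Sum>j<m. x n j *\<^sub>R e j)) n\<bar> \<le> L * N (x n - (\<Sum>j<m. x n j *\<^sub>R e j))"
    by (rule L(2)) auto
  ultimately show False by (simp add: coeff_minus_unit_combination zero)
qed

text \<open>
  Otherwise, removing the coordinates of \<open>x_n\<close> above \<open>\<tau>\<close> hardly changes the value of \<open>x_n*\<close>: their
  number is bounded in terms of \<open>\<tau>\<close> since \<open>l / s l\<close> is unbounded, and each
  contributes little.
\<close>

lemma dual_coord_uniformly_large: "\<exists>\<delta>>0. \<forall>n. \<exists>j. \<delta> \<le> \<bar>coeff (e j) n\<bar>"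
proof (rule ccontr)
  assume not: "\<not> ?thesis"
  obtain U where U: "0 < U" "\<And>n. N (x n) \<le> U" using norm_x_upper by blast
  show False
  proof (rule no_flat_test_vectors)
    fix \<tau> :: real and F :: "nat set" assume \<tau>: "0 < \<tau>" and F: "finite F"
    obtain l where "0 < l" "(U / \<tau>) * s l < real l" using linear_beats_s by blast
    then have l: "U * s l < \<tau> * real l" using \<tau> by (simp add: field_simps)
    \<comment> \<open>At most \<open>l\<close> coordinates of \<open>x n\<close> exceed \<open>\<tau>\<close>, each at most \<open>U * s 1\<close>; dual coordinates below
      \<open>1 / (2 * b)\<close> make their total contribution to the coefficient at most \<open>1/2\<close>.\<close>
    define b where "b = real l * (U * s (Suc 0))"
    have "0 < b" using \<open>0 < l\<close> U(1) s_1_pos by (simp add: b_def)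
    then have "0 < 1 / (2 * b)" by simp
    then obtain n where n: "n \<notin> F" "\<And>j. \<bar>coeff (e j) n\<bar> < 1 / (2 * b)"
      using uniformly_small_outside_finite[of "\<lambda>n j. \<bar>coeff (e j) n\<bar>", OF dual_coord_nonzero not F] by blast
    define G where "G = {j. \<tau> \<le> \<bar>x n j\<bar>}"
    have G: "finite G" unfolding G_def using \<tau> by (intro finite_abs_ge space_tendsto) auto
    have "card G < l"
    proof (rule ccontr)
      assume "\<not> card G < l"
      then obtain H where H: "H \<subseteq> G" "card H = l" "finite H"
        using obtain_subset_with_card_n[of l G] by (metis not_less)
      have "\<tau> * real l \<le> (\<Sum>j\<in>H. \<bar>x n j\<bar>)"
        using H sum_bounded_below[of H \<tau> "\<lambda>j. \<bar>x n j\<bar>"] by (auto simp: G_def mult.commute)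
      also have "\<dots> \<le> N (x n) * s (card H)" using H by (intro sum_le_norm) auto
      also have "\<dots> \<le> U * s l" using U H s_nonneg by (simp add: mult_right_mono)
      finally show False using l by simp
    qed
    define v where "v = x n - (\<Sum>j\<in>G. x n j *\<^sub>R e j)"
    have v: "v j = (if j \<in> G then 0 else x n j)" for j
      by (simp add: v_def unit_combination_apply[OF G])
    have "(\<Sum>j\<in>G. x n j * coeff (e j) n) \<le> real (card G) * (U * s (Suc 0) * (1 / (2 * b)))"
    proof (rule sum_bounded_above)
      fix j
      have "x n j * coeff (e j) n \<le> \<bar>x n j\<bar> * \<bar>coeff (e j) n\<bar>" by (metis abs_ge_self abs_mult)
      also have "\<bar>x n j\<bar> \<le> U * s (Suc 0)"
        using coord_le_norm[OF x_in_space, of n j] U(2)[of n] s_1_pos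
        by (meson less_imp_le mult_right_mono order_trans)
      also have "U * s (Suc 0) * \<bar>coeff (e j) n\<bar> \<le> U * s (Suc 0) * (1 / (2 * b))"
        using n(2)[of j] U(1) s_1_pos by (intro mult_left_mono) auto
      finally show "x n j * coeff (e j) n \<le> U * s (Suc 0) * (1 / (2 * b))"
        by (simp add: mult_right_mono)
    qed
    also have "\<dots> \<le> real l * (U * s (Suc 0) * (1 / (2 * b)))"
      using \<open>card G < l\<close> U(1) s_1_pos \<open>0 < b\<close> by (intro mult_right_mono) auto
    also have "\<dots> = b * (1 / (2 * b))" by (simp add: b_def)
    also have "\<dots> = 1 / 2" using \<open>0 < b\<close> by simp
    finally have "1/2 \<le> coeff v n" unfolding v_def coeff_minus_unit_combination[OF G] by simp
    moreover have "v \<in> V" by (auto simp: v_def)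
    moreover have "\<bar>v j\<bar> \<le> \<bar>x n j\<bar>" "\<bar>v j\<bar> \<le> \<tau>" for j
      using \<tau> by (auto simp: v G_def)
    ultimately show "\<exists>n v. n \<notin> F \<and> v \<in> V \<and> (\<forall>j. \<bar>v j\<bar> \<le> \<bar>x n j\<bar>) \<and> (\<forall>j. \<bar>v j\<bar> \<le> \<tau>) \<and> 1/2 \<le> coeff v n"
      using n(1) by blast
  qed
qed

text \<open>
  To bound a functional \<open>f\<close> at \<open>\<Sum>n\<in>A. a n *\<^sub>R x n\<close>, the pairing lemma reduces the task to the
  Lorentz norm of \<open>f (x n)\<close>, which is found by testing on \<open>\<Sum> \<plusminus> w (\<sigma> n) *\<^sub>R e (j n)\<close>. The fibres of
  \<open>j\<close> are bounded because the expansion of a single unit vector cannot have many large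
  coefficients: sums of many basis vectors are large.
\<close>

lemma dominated_by_units:
  "\<exists>D. 0 \<le> D \<and> (\<forall>A a. finite A \<longrightarrow> N (\<Sum>n\<in>A. a n *\<^sub>R x n) \<le> D * N (\<Sum>n\<in>A. a n *\<^sub>R e n))"
proof -
  obtain \<delta> where \<delta>: "0 < \<delta>" "\<forall>n. \<exists>j. \<delta> \<le> \<bar>coeff (e j) n\<bar>" using dual_coord_uniformly_large by blast
  then obtain j where j: "\<And>n. \<delta> \<le> \<bar>coeff (e (j n)) n\<bar>" by metis
  \<comment> \<open>Sums over more than \<open>card A0\<close> indices exceed what one unit vector can dominate.\<close>
  obtain A0 where A0: "finite A0" "C * C * K * (K * (1 / s (Suc 0) / \<delta>)) < N (\<Sum>n\<in>A0. x n)"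
    using basis_sums_unbounded by blast
  define M where "M = card A0"
  have mult: "card A \<le> M" if A: "finite A" "\<And>n. n \<in> A \<Longrightarrow> j n = i" for A i
  proof (rule ccontr)
    assume "\<not> card A \<le> M"
    then have "N (\<Sum>n\<in>A0. x n) \<le> C * C * K * N (\<Sum>n\<in>A. x n)"
      using A0 A by (intro democratic) (auto simp: M_def)
    also have "N (\<Sum>n\<in>A. x n) \<le> K * (1 / s (Suc 0) / \<delta>)"
    proof -
      have e\<delta>: "(1/\<delta>) *\<^sub>R e i \<in> V" by auto
      have c: "coeff ((1/\<delta>) *\<^sub>R e i) n = coeff (e i) n / \<delta>" for n
        using coeff_sum[of "{i}" e "\<lambda>_. 1/\<delta>" n] by simp
      have ge: "\<delta> \<le> \<bar>coeff (e i) n\<bar>" if "n \<in> A" for n using j[of n] A(2)[OF that] by simp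
      have "N (\<Sum>n\<in>A. ((\<delta> / coeff (e i) n) * coeff ((1/\<delta>) *\<^sub>R e i) n) *\<^sub>R x n) \<le> K * N ((1/\<delta>) *\<^sub>R e i)"
        using ge \<delta>(1) A(1) e\<delta> by (intro norm_multiplier_le) (auto simp: divide_le_eq)
      moreover have "(\<Sum>n\<in>A. ((\<delta> / coeff (e i) n) * coeff ((1/\<delta>) *\<^sub>R e i) n) *\<^sub>R x n) = (\<Sum>n\<in>A. x n)"
      proof (rule sum.cong)
        fix n assume "n \<in> A"
        then have "coeff (e i) n \<noteq> 0" using ge[of n] \<delta>(1) by auto
        then show "((\<delta> / coeff (e i) n) * coeff ((1/\<delta>) *\<^sub>R e i) n) *\<^sub>R x n = x n"
          using \<delta>(1) by (simp add: c)
      qed simp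
      moreover have "N ((1/\<delta>) *\<^sub>R e i) = 1 / s (Suc 0) / \<delta>"
        using \<delta>(1) by (subst scale) (auto simp: norm_unit)
      ultimately show ?thesis by simp
    qed
    finally show False using A0(2) C_ge_1 K_pos by (simp add: mult_left_mono)
  qed
  define D where "D = real M * (K / \<delta>)"
  have "0 \<le> D" using \<delta>(1) K_pos by (simp add: D_def)
  have "N (\<Sum>n\<in>A. a n *\<^sub>R x n) \<le> D * N (\<Sum>n\<in>A. a n *\<^sub>R e n)" if A: "finite A" for A a
  proof (rule norm_le_by_signed_sums)
    define r where "r = N (\<Sum>n\<in>A. a n *\<^sub>R e n)"
    have unitX: "(\<Sum>n\<in>A. a n *\<^sub>R e n) \<in> X" by (intro sep_in_space) auto
    have "0 \<le> r" unfolding r_def by (rule norm_nonneg[OF unitX])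
    show "(\<Sum>n\<in>A. a n *\<^sub>R x n) \<in> X" by (intro sep_in_space) auto
    fix B :: "nat set" and \<eta> :: "nat \<Rightarrow> real" assume B: "finite B" and \<eta>: "\<And>j. \<bar>\<eta> j\<bar> \<le> 1"
    define f where "f y = (\<Sum>j\<in>B. \<eta> j * y j)" for y :: "nat \<Rightarrow> real"
    have f: "linear f" unfolding f_def by (rule linear_signed_sum)
    have f_le: "f y \<le> s (card B) * N y" if "y \<in> V" for y
      unfolding f_def using that by (intro signed_sum_le_norm sep_in_space B \<eta>)
    have "\<exists>\<sigma>. inj_on \<sigma> A \<and> (\<Sum>n\<in>A. \<bar>a n * f (x n)\<bar>) \<le> r * (\<Sum>n\<in>A. \<bar>f (x n)\<bar> * w (\<sigma> n))"
    proof (rule rearrangement_pairing[OF A \<open>0 \<le> r\<close>])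
      fix I assume I: "I \<subseteq> A"
      then have "(\<Sum>n\<in>I. \<bar>a n\<bar>) = (\<Sum>i\<in>I. \<bar>(\<Sum>n\<in>A. a n *\<^sub>R e n) i\<bar>)"
        by (intro sum.cong) (auto simp: unit_combination_apply[OF A])
      also have "\<dots> \<le> r * s (card I)"
        unfolding r_def using I A finite_subset by (intro sum_le_norm unitX) auto
      finally show "(\<Sum>n\<in>I. \<bar>a n\<bar>) \<le> r * (\<Sum>i<card I. w i)" by (simp add: primitive_weight_def)
    qed
    then obtain \<sigma> where \<sigma>: "inj_on \<sigma> A"
      and pair: "(\<Sum>n\<in>A. \<bar>a n * f (x n)\<bar>) \<le> r * (\<Sum>n\<in>A. \<bar>f (x n)\<bar> * w (\<sigma> n))" by blast
    have "\<exists>A'\<subseteq>A. inj_on j A' \<and>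
        (\<Sum>n\<in>A. \<bar>f (x n)\<bar> * w (\<sigma> n)) \<le> real M * (\<Sum>n\<in>A'. \<bar>f (x n)\<bar> * w (\<sigma> n))"
    proof (rule injective_representatives[OF A])
      show "card {n \<in> A. j n = y} \<le> M" for y using A by (intro mult) auto
    qed (simp add: less_imp_le[OF pos])
    then obtain A' where A': "A' \<subseteq> A" "inj_on j A'"
      and rep: "(\<Sum>n\<in>A. \<bar>f (x n)\<bar> * w (\<sigma> n)) \<le> real M * (\<Sum>n\<in>A'. \<bar>f (x n)\<bar> * w (\<sigma> n))" by blast
    have A'_fin: "finite A'" using A A' finite_subset by blast
    have "\<delta> * (\<Sum>n\<in>A'. \<bar>f (x n)\<bar> * w (\<sigma> n)) \<le> (\<Sum>n\<in>A'. \<bar>f (x n) * coeff (w (\<sigma> n) *\<^sub>R e (j n)) n\<bar>)"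
      unfolding sum_distrib_left
    proof (rule sum_mono)
      fix n
      have "coeff (w (\<sigma> n) *\<^sub>R e (j n)) n = w (\<sigma> n) * coeff (e (j n)) n"
        using coeff_sum[of "{0::nat}" "\<lambda>_. e (j n)" "\<lambda>_. w (\<sigma> n)" n] by simp
      moreover have "\<delta> * (\<bar>f (x n)\<bar> * w (\<sigma> n)) \<le> \<bar>coeff (e (j n)) n\<bar> * (\<bar>f (x n)\<bar> * w (\<sigma> n))"
        using j pos by (intro mult_right_mono) (auto simp: less_imp_le)
      ultimately show "\<delta> * (\<bar>f (x n)\<bar> * w (\<sigma> n)) \<le> \<bar>f (x n) * coeff (w (\<sigma> n) *\<^sub>R e (j n)) n\<bar>"
        using pos[of "\<sigma> n"] by (simp add: abs_mult mult_ac)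
    qed
    also have "\<dots> \<le> s (card B) * (K * 1)"
    proof (rule functional_test_vectors[OF A'_fin _ f])
      show "N (\<Sum>n\<in>A'. \<epsilon> n *\<^sub>R (w (\<sigma> n) *\<^sub>R e (j n))) \<le> 1" if "\<forall>n. \<bar>\<epsilon> n\<bar> = 1" for \<epsilon>
        using A' A'_fin \<sigma> that by (intro norm_weighted_units_le) (auto intro: inj_on_subset)
    qed (use f_le s_nonneg in auto)
    finally have test: "(\<Sum>n\<in>A'. \<bar>f (x n)\<bar> * w (\<sigma> n)) \<le> s (card B) * K / \<delta>"
      using \<delta>(1) by (simp add: pos_le_divide_eq mult.commute)
    have "f (\<Sum>n\<in>A. a n *\<^sub>R x n) = (\<Sum>n\<in>A. a n * f (x n))"
      using f by (simp add: linear_sum linear_scale)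
    also have "\<dots> \<le> (\<Sum>n\<in>A. \<bar>a n * f (x n)\<bar>)" by (intro sum_mono) simp
    also have "\<dots> \<le> r * (real M * (s (card B) * K / \<delta>))"
      using \<open>0 \<le> r\<close> test by (intro order_trans[OF pair] mult_left_mono order_trans[OF rep]) auto
    finally show "(\<Sum>j\<in>B. \<eta> j * (\<Sum>n\<in>A. a n *\<^sub>R x n) j) \<le> s (card B) * (D * N (\<Sum>n\<in>A. a n *\<^sub>R e n))"
      unfolding f_def D_def r_def by (simp add: mult_ac)
  qed
  then show ?thesis using \<open>0 \<le> D\<close> by blast
qed

text \<open>
  The coordinate functionals at \<open>j n\<close> serve as test functionals. The fibres of \<open>j\<close> are bounded
  because \<open>M\<close> basis vectors that are large at one coordinate have, with signs, a sum of norm at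
  least a multiple of \<open>M\<close>, while the upper bound by unit vectors allows only
  \<open>M / s M\<close> times a constant.
\<close>

lemma dominates_units:
  "\<exists>D. 0 \<le> D \<and> (\<forall>A a. finite A \<longrightarrow> N (\<Sum>n\<in>A. a n *\<^sub>R e n) \<le> D * N (\<Sum>n\<in>A. a n *\<^sub>R x n))"
proof -
  obtain \<delta> where \<delta>: "0 < \<delta>" "\<forall>n. \<exists>j. \<delta> \<le> \<bar>x n j\<bar>" using coord_uniformly_large by blast
  then obtain j where j: "\<And>n. \<delta> \<le> \<bar>x n (j n)\<bar>" by metis
  obtain D0 where D0: "0 \<le> D0"
    "\<And>A a. finite A \<Longrightarrow> N (\<Sum>n\<in>A. a n *\<^sub>R x n) \<le> D0 * N (\<Sum>n\<in>A. a n *\<^sub>R e n)"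
    using dominated_by_units by blast
  obtain M where M: "D0 * s (Suc 0) / \<delta> + 1 \<le> s M" using unbounded by blast
  have "0 \<le> D0 * s (Suc 0) / \<delta>" using D0(1) s_nonneg \<delta>(1) by simp
  then have sM: "0 < s M" using M by linarith
  then have "0 < M" by (cases M) auto
  have mult: "card A \<le> M" if A: "finite A" "\<And>n. n \<in> A \<Longrightarrow> j n = i" for A i
  proof (rule ccontr)
    assume "\<not> card A \<le> M"
    then obtain A' where A': "A' \<subseteq> A" "card A' = M" "finite A'"
      using obtain_subset_with_card_n[of M A] by (metis nle_le)
    define y where "y = (\<Sum>n\<in>A'. sgn (x n i) *\<^sub>R x n)"
    have y: "y \<in> X" unfolding y_def by (intro sep_in_space) auto
    have "real M * \<delta> \<le> (\<Sum>n\<in>A'. \<bar>x n i\<bar>)"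
    proof -
      have "\<delta> \<le> \<bar>x n i\<bar>" if "n \<in> A'" for n using j[of n] A(2)[of n] A' that by auto
      then show ?thesis using sum_bounded_below[of A' \<delta> "\<lambda>n. \<bar>x n i\<bar>"] A' by simp
    qed
    also have "\<dots> = y i" by (simp add: y_def sum_fun_apply abs_sgn mult.commute)
    also have "\<dots> \<le> N y * s (Suc 0)" using coord_le_norm[OF y, of i] by simp
    also have "N y \<le> D0 * N (\<Sum>n\<in>A'. sgn (x n i) *\<^sub>R e n)" unfolding y_def by (rule D0(2)[OF A'(3)])
    also have "N (\<Sum>n\<in>A'. sgn (x n i) *\<^sub>R e n) \<le> real M / s M"
      using norm_unimodular_le[OF A'(3), of "\<lambda>n. sgn (x n i)"] A'(2) by (simp add: abs_sgn_eq)
    finally have "real M * \<delta> \<le> D0 * (real M / s M) * s (Suc 0)"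
      using D0(1) s_nonneg by (simp add: mult_left_mono mult_right_mono)
    then have "s M \<le> D0 * s (Suc 0) / \<delta>" using \<open>0 < M\<close> sM \<delta>(1) by (simp add: field_simps)
    then show False using M by simp
  qed
  define D where "D = real M * (K / \<delta>)"
  have "0 \<le> D" using \<delta>(1) K_pos by (simp add: D_def)
  have "N (\<Sum>n\<in>A. a n *\<^sub>R e n) \<le> D * N (\<Sum>n\<in>A. a n *\<^sub>R x n)" if A: "finite A" for A a
  proof (rule norm_leI(2))
    define r where "r = N (\<Sum>n\<in>A. a n *\<^sub>R x n)"
    have "0 \<le> r" unfolding r_def by (intro norm_nonneg sep_in_space) auto
    show "(\<Sum>n\<in>A. a n *\<^sub>R e n) \<longlonglongrightarrow> 0" by (intro space_tendsto sep_in_space) auto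
    fix B :: "nat set" assume B: "finite B"
    have "\<exists>A'\<subseteq>B \<inter> A. inj_on j A' \<and> (\<Sum>n\<in>B \<inter> A. \<bar>a n\<bar>) \<le> real M * (\<Sum>n\<in>A'. \<bar>a n\<bar>)"
    proof (rule injective_representatives)
      show "card {n \<in> B \<inter> A. j n = y} \<le> M" for y using A by (intro mult) auto
    qed (use A in auto)
    then obtain A' where A': "A' \<subseteq> B \<inter> A" "inj_on j A'"
      and rep: "(\<Sum>n\<in>B \<inter> A. \<bar>a n\<bar>) \<le> real M * (\<Sum>n\<in>A'. \<bar>a n\<bar>)" by blast
    have A'_fin: "finite A'" "A' \<subseteq> A" and A'_card: "card A' \<le> card B"
      using A A' B by (auto intro: finite_subset card_mono)
    have "\<delta> * (\<Sum>n\<in>A'. \<bar>a n\<bar>) \<le> (\<Sum>n\<in>A'. \<bar>a n * x n (j n)\<bar>)"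
      unfolding sum_distrib_left
    proof (rule sum_mono)
      show "\<delta> * \<bar>a n\<bar> \<le> \<bar>a n * x n (j n)\<bar>" for n
        using mult_right_mono[OF j[of n], of "\<bar>a n\<bar>"] by (simp add: abs_mult mult.commute)
    qed
    also have "\<dots> \<le> s (card A') * (K * r)"
      unfolding r_def
    proof (rule combination_test_functionals[OF A A'_fin(2), of "\<lambda>n y. y (j n)"])
      show "linear (\<lambda>y :: nat \<Rightarrow> real. y (j n))" for n by (rule linear_eval)
      fix \<epsilon> :: "nat \<Rightarrow> real" and y assume y: "y \<in> V" and \<epsilon>: "\<forall>n. \<bar>\<epsilon> n\<bar> = 1"
      have "(\<Sum>n\<in>A'. \<epsilon> n * y (j n)) \<le> (\<Sum>n\<in>A'. \<bar>y (j n)\<bar>)"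
        using \<epsilon> by (intro sum_mono) (metis abs_ge_self abs_mult mult_1)
      also have "\<dots> = (\<Sum>i\<in>j ` A'. \<bar>y i\<bar>)" by (simp add: sum.reindex[OF A'(2)])
      also have "\<dots> \<le> N y * s (card (j ` A'))" using y A'_fin by (intro sum_le_norm sep_in_space) auto
      finally show "(\<Sum>n\<in>A'. \<epsilon> n * y (j n)) \<le> s (card A') * N y"
        by (simp add: card_image[OF A'(2)] mult.commute)
    qed (rule s_nonneg)
    also have "\<dots> \<le> s (card B) * (K * r)"
      using \<open>0 \<le> r\<close> K_pos A'_card by (intro mult_right_mono s_mono) auto
    finally have *: "(\<Sum>n\<in>A'. \<bar>a n\<bar>) \<le> s (card B) * (K * r) / \<delta>"
      using \<delta>(1) by (simp add: pos_le_divide_eq mult.commute)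
    have "(\<Sum>i\<in>B. \<bar>(\<Sum>n\<in>A. a n *\<^sub>R e n) i\<bar>) = (\<Sum>n\<in>B \<inter> A. \<bar>a n\<bar>)"
      using B by (simp add: unit_combination_apply[OF A] if_distrib sum.inter_restrict cong: if_cong)
    also have "\<dots> \<le> real M * (s (card B) * (K * r) / \<delta>)"
      using * by (intro order_trans[OF rep] mult_left_mono) auto
    finally show "(\<Sum>i\<in>B. \<bar>(\<Sum>n\<in>A. a n *\<^sub>R e n) i\<bar>) \<le> D * N (\<Sum>n\<in>A. a n *\<^sub>R x n) * s (card B)"
      unfolding r_def D_def by (simp add: mult_ac)
  qed
  then show ?thesis using \<open>0 \<le> D\<close> by blast
qed

lemma equivalent_to_units: "equivalent_bases N e x"
proof -
  obtain D1 where D1: "0 \<le> D1"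
    "\<And>A a. finite A \<Longrightarrow> N (\<Sum>n\<in>A. a n *\<^sub>R x n) \<le> D1 * N (\<Sum>n\<in>A. a n *\<^sub>R e n)"
    using dominated_by_units by blast
  obtain D2 where D2: "0 \<le> D2"
    "\<And>A a. finite A \<Longrightarrow> N (\<Sum>n\<in>A. a n *\<^sub>R e n) \<le> D2 * N (\<Sum>n\<in>A. a n *\<^sub>R x n)"
    using dominates_units by blast
  define D where "D = 1 + D1 + D2"
  have D: "1 \<le> D" "D1 \<le> D" "D2 \<le> D" using D1(1) D2(1) by (auto simp: D_def)
  show ?thesis
    unfolding equivalent_bases_def
  proof (intro exI[of _ D] conjI ballI)
    fix a assume "a \<in> c00"
    define A where "A = {n. a n \<noteq> 0}"
    have A: "finite A" using \<open>a \<in> c00\<close> by (simp add: c00_def A_def)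
    define p where "p = N (\<Sum>n\<in>A. a n *\<^sub>R e n)"
    define q where "q = N (\<Sum>n\<in>A. a n *\<^sub>R x n)"
    have "0 \<le> p" "0 \<le> q" unfolding p_def q_def by (intro nonneg; auto)+
    then have "p \<le> D * q" "q \<le> D * p"
      using D1(2)[OF A, of a] D2(2)[OF A, of a] D
      by (auto simp flip: p_def q_def intro: order_trans mult_right_mono)
    then show "inverse D * N (\<Sum>n | a n \<noteq> 0. a n *\<^sub>R e n) \<le> N (\<Sum>n | a n \<noteq> 0. a n *\<^sub>R x n)"
      "N (\<Sum>n | a n \<noteq> 0. a n *\<^sub>R x n) \<le> D * N (\<Sum>n | a n \<noteq> 0. a n *\<^sub>R e n)"
      using D(1) by (simp_all add: A_def p_def q_def field_simps)
  qed (rule D(1))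
qed

end

text \<open>
  Since \<open>s n \<ge> w 0\<close> for \<open>n \<ge> 1\<close>, regularity bounds \<open>w n\<close> below by a multiple of \<open>1 / (n + 1)\<close>, and the
  harmonic series diverges.
\<close>

lemma regular_weight_unbounded:
  assumes pos: "\<And>n. 0 < w n" and "regular_weight w"
  shows "\<exists>n. M \<le> primitive_weight w n"
proof (rule ccontr)
  assume "\<not> ?thesis"
  then have M: "(\<Sum>i<n. w i) \<le> M" for n by (simp add: primitive_weight_def not_le less_imp_le)
  obtain c where c: "\<And>n. primitive_weight w (Suc n) / real (Suc n) \<le> c * w n"
    using assms(2) by (auto simp: regular_weight_def)
  have "summable w" using pos M by (intro summableI_nonneg_bounded) (auto intro: less_imp_le)
  then have "summable (\<lambda>n. c / w 0 * w n)" by (rule summable_mult)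
  then have "summable (\<lambda>n. inverse (real (Suc n)))"
  proof (rule summable_comparison_test')
    fix n :: nat
    have "w 0 \<le> primitive_weight w (Suc n)"
      unfolding primitive_weight_def using pos by (intro member_le_sum) (auto intro: less_imp_le)
    then have "w 0 / real (Suc n) \<le> c * w n"
      using c[of n] by (meson divide_right_mono of_nat_0_le_iff order_trans)
    then show "norm (inverse (real (Suc n))) \<le> c / w 0 * w n"
      using pos[of 0] by (simp add: field_simps)
  qed
  then show False
    using not_summable_harmonic[where 'a = real] summable_Suc_iff[of "\<lambda>n. inverse (real n)"] by blast
qed

theorem theorem6p6:
  fixes w :: "nat \<Rightarrow> real"
  assumes "is_weight w"
    and "regular_weight w"
    and "decreasing_to_zero w"
    and "submultiplicative (primitive_weight w)"
  shows "has_unique_greedy_basis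
           (marcinkiewicz_separable_part (primitive_weight w))
           (marcinkiewicz_norm (primitive_weight w))"
proof -
  interpret lorentz_weight w
    using assms regular_weight_unbounded[of w]
    by unfold_locales (auto simp: is_weight_def decreasing_to_zero_def)
  have "equivalent_bases N e x" if x: "greedy_basis V N x" for x
  proof -
    obtain C where "greedy_with_constant V N x C" using greedy_basis_imp_constant[OF x] by blast
    then interpret greedy_with_constant V N x C .
    interpret greedy_basis_of_marcinkiewicz w x C ..
    show ?thesis by (rule equivalent_to_units)
  qed
  then show ?thesis unfolding has_unique_greedy_basis_def using unit_greedy by blast
qed

end
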